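(* Let $(\mathcal{X},\mathcal{A},P)$ be a probability space, $f\in L_2(P)$ real-valued, and $h=(h_1,\ldots,h_m)^T$ control variates $h_j\in L_2(P)$ with $P(h_j)=0$. Fix a minimizer $\beta^\star(f)\in\arg\min_{\beta\in\mathbb{R}^m}P[(f-P(f)-\beta^Th)^2]$, let $\epsilon=f-P(f)-\beta^\star(f)^Th$, $S^\star=\operatorname{supp}(\beta^\star(f))=\{j:\beta^\star_j(f)\neq0\}$, assumed nonempty, and $\ell^\star=|S^\star|$. Assume: (i) $\epsilon\in\mathcal{G}(\tau^2)$ for some $\tau>0$; (ii) $U_h:=\max_j\sup_{x\in\mathcal{X}}|h_j(x)|<\infty$; (iii) (restricted eigenvalue condition) there exists $\gamma^\star>0$ such that $u^TGu\ge\gamma^\star\|u\|_2^2$ for all $u\in\mathcal{C}(S^\star;3)$, where $G=P(hh^T)$. Let $\xi=\ell^\star U_h^2/\gamma^\star$ and let $X_1,\ldots,X_n$ be i.i.d. $P$. Then for all $\delta\in(0,1)$, all integers $n$ and all $\lambda$ with $$n\ge\max\bigl(8\xi^2\log(8m^2/\delta),\;128\xi\log(8m/\delta)\bigr),\qquad \lambda\ge7U_h\sqrt{\log(8m/\delta)}\,\tau/\sqrt n,$$ with probability at least $1-\delta$, $$|\hat\alpha_n^{\mathrm{lasso}}(f)-P(f)|\le\sqrt{2\log(8/\delta)}\frac{\tau}{\sqrt n}+68\lambda\ell^\star\sqrt{\log(8m/\delta)}\frac{U_h/\gamma^\star}{\sqrt n},$$ and, when $\lambda$ equals the lower bound $7U_h\sqrt{\log(8m/\delta)}\tau/\sqrt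 n$, on the same event $$|\hat\alpha_n^{\mathrm{lasso}}(f)-P(f)|\le\sqrt{2\log(8/\delta)}\frac{\tau}{\sqrt n}+476\,\ell^\star\log(8m/\delta)(U_h^2/\gamma^\star)\frac{\tau}{n}.$$
   Context: $P(g)=\int g\,dP$, $P_n(g)=n^{-1}\sum_{i=1}^ng(X_i)$. A centered random variable $Y$ is in $\mathcal{G}(\tau^2)$ if $\log\mathbb{E}[e^{\lambda Y}]\le\lambda^2\tau^2/2$ for all real $\lambda$; for a function $\epsilon$ this means $\int e^{\lambda\epsilon}dP\le e^{\lambda^2\tau^2/2}$ for all $\lambda$. For $S\subset\{1,\ldots,m\}$, $\overline S$ its complement, $u_S=(u_k)_{k\in S}$, and $\mathcal{C}(S;\alpha)=\{u\in\mathbb{R}^m:\|u_{\overline S}\|_1\le\alpha\|u_S\|_1\}$. With $f^{(n)}=(f(X_i))_{i\le n}$, $H=(h_j(X_i))_{i,j}$, $f_c^{(n)}=f^{(n)}-\mathbb{1}_n(\mathbb{1}_n^Tf^{(n)})/n$, $H_c=H-\mathbb{1}_n(\mathbb{1}_n^TH)/n$, the LASSO estimator with parameter $\lambda>0$ is $\hat\alpha_n^{\mathrm{lasso}}(f)=P_n[f-\hat\beta_n^{\mathrm{lasso}}(f)^Th]$ where $\hat\beta_n^{\mathrm{lasso}}(f)\in\arg\min_{\beta\in\mathbb{R}^m}\frac{1}{2n}\|f_c^{(n)}-H_c\beta\|_2^2+\lambda\|\beta\|_1$. *)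

theory Defs
  imports "HOL-Probability.Probability"
begin

definition subgaussian :: "'a measure \<Rightarrow> real \<Rightarrow> ('a \<Rightarrow> real) \<Rightarrow> bool" where
  "subgaussian M tau2 eps \<longleftrightarrow>
     (\<forall>l::real. (\<integral>\<^sup>+ x. ennreal (exp (l * eps x)) \<partial>M) \<le> ennreal (exp (l\<^sup>2 * tau2 / 2)))"

definition pop_risk :: "'a measure \<Rightarrow> ('a \<Rightarrow> real) \<Rightarrow> ('m::finite \<Rightarrow> 'a \<Rightarrow> real) \<Rightarrow> real^'m \<Rightarrow> real" where
  "pop_risk M f h \<beta> = (\<integral>x. (f x - (\<integral>y. f y \<partial>M) - (\<Sum>j\<in>UNIV. \<beta>$j * h j x))\<^sup>2 \<partial>M)"

definition supp_vec :: "real^'m::finite \<Rightarrow> 'm set" where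
  "supp_vec \<beta> = {j. \<beta>$j \<noteq> 0}"

definition cone_set :: "'m::finite set \<Rightarrow> real \<Rightarrow> (real^'m) set" where
  "cone_set S \<alpha> = {u. (\<Sum>j\<in>UNIV - S. \<bar>u$j\<bar>) \<le> \<alpha> * (\<Sum>j\<in>S. \<bar>u$j\<bar>)}"

definition gram :: "'a measure \<Rightarrow> ('m::finite \<Rightarrow> 'a \<Rightarrow> real) \<Rightarrow> 'm \<Rightarrow> 'm \<Rightarrow> real" where
  "gram M h j k = (\<integral>x. h j x * h k x \<partial>M)"

definition U_h :: "'a measure \<Rightarrow> ('m::finite \<Rightarrow> 'a \<Rightarrow> real) \<Rightarrow> real" where
  "U_h M h = Max ((\<lambda>j. SUP x\<in>space M. \<bar>h j x\<bar>) ` UNIV)"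

definition emp_mean :: "nat \<Rightarrow> (nat \<Rightarrow> 'a) \<Rightarrow> ('a \<Rightarrow> real) \<Rightarrow> real" where
  "emp_mean n X g = (\<Sum>i<n. g (X i)) / real n"

definition lasso_obj :: "nat \<Rightarrow> (nat \<Rightarrow> 'a) \<Rightarrow> ('a \<Rightarrow> real) \<Rightarrow> ('m::finite \<Rightarrow> 'a \<Rightarrow> real)
                          \<Rightarrow> real \<Rightarrow> real^'m \<Rightarrow> real" where
  "lasso_obj n X f h lam \<beta> =
     (\<Sum>i<n. ((f (X i) - emp_mean n X f)
              - (\<Sum>j\<in>UNIV. (h j (X i) - emp_mean n X (h j)) * \<beta>$j))\<^sup>2) / (2 * real n)
     + lam * (\<Sum>j\<in>UNIV. \<bar>\<beta>$j\<bar>)"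

definition is_lasso_beta :: "nat \<Rightarrow> (nat \<Rightarrow> 'a) \<Rightarrow> ('a \<Rightarrow> real) \<Rightarrow> ('m::finite \<Rightarrow> 'a \<Rightarrow> real)
                          \<Rightarrow> real \<Rightarrow> real^'m \<Rightarrow> bool" where
  "is_lasso_beta n X f h lam \<beta> \<longleftrightarrow> (\<forall>\<beta>'. lasso_obj n X f h lam \<beta> \<le> lasso_obj n X f h lam \<beta>')"

definition lasso_alpha :: "nat \<Rightarrow> (nat \<Rightarrow> 'a) \<Rightarrow> ('a \<Rightarrow> real) \<Rightarrow> ('m::finite \<Rightarrow> 'a \<Rightarrow> real)
                          \<Rightarrow> real^'m \<Rightarrow> real" where
  "lasso_alpha n X f h \<beta> = emp_mean n X (\<lambda>x. f x - (\<Sum>j\<in>UNIV. \<beta>$j * h j x))"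

end

(*
  Write u for the error of the LASSO coefficients, S for the support of the minimizer, and
  sigma for its sign vector on S.  For every sign pattern theta on S, the restricted eigenvalue
  condition yields a dual certificate v with (G v)_j = theta_j on S and |(G v)_j| <= 1/3 off S,
  whose quadratic form is at most |S| / gamma: v minimizes
  w |-> (w^T G w) / 2 - theta^T w_S + |w_(S^c)|_1 / 3, whose nonpositive level set lies in the cone.

  In the basic inequality the empirical quadratic form is bounded below by
  a^2 >= 2 a b - b^2 with b = lam (v_(-sigma) + v_(sgn u) / 2)^T h.  In the population version,
  the linear part then dominates lam |u|_1 / 2, which bounds |u|_1 by a multiple of
  lam |S| / gamma.  Only linear functionals h_j v^T h of the Gram matrix have to concentrate,
  for v in a family of 2^|S| certificates; an entrywise bound on the Gram matrix over the whole
  cone would need a larger sample size.  The fluctuations of the noise term and of v_(-sigma)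
  are controlled jointly, so that their variances add up instead of their standard deviations;
  the numerical constants leave no room for treating them separately.
*)
theory Submission
  imports Defs
begin

text \<open>The weight 1/2 on the certificate of sgn u balances two margins. With weight k, the
  coordinates in S have slack k |u_j|, because the certificate of -sigma cancels the tangent of the
  penalty there; the coordinates off S have slack (1 - 1/3 - k/3) |u_j|. The two agree at k = 1/2.
  The level 1/3 is dual to the aperture 3 of the cone: it is what turns nonpositivity of the
  objective into |w off S|_1 \<le> 3 |w on S|_1.

  Only the pattern sgn u depends on the sample. The pattern -sigma is fixed, so the unbounded noise
  is paired with one certificate and costs a union over m coordinates, while the factor 2^|S| is
  paid by bounded variables whose variance is as small as their range.

  The estimation error is P_n(\<epsilon>) minus u^T P_n(h). The second term is at most |u|_1 max_j
  |P_n(h_j)|, and the maximum is of size U sqrt(2 log(8m/\<delta>) / n). Hence 68 in the claim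
  leaves room for |u|_1 \<le> 48 lam |S| / \<gamma>, as 48 sqrt 2 < 68.\<close>

section \<open>Exponential moments and Chernoff bounds\<close>

text \<open>This is the second derivative of the Taylor bound that follows. In
  \<open>y = exp x\<close> it reads 10 y^5 \<le> y^8 + 10 y^4 + 1. A tangent inequality multiplied
  by y^4 removes the odd power, and the rest is quadratic in y^4.\<close>

lemma exp_le_1_add_cosh_four:
  fixes x :: real
  shows "exp x \<le> 1 + cosh (4 * x) / 5"
proof -
  define y where "y = exp x"
  have y: "y > 0" by (simp add: y_def)
  \<comment> \<open>AM-GM for the tangent of \<open>y ^ 4\<close> at \<open>69/50\<close>, near which the claim is tightest\<close>
  have "0 \<le> (y\<^sup>2 - (69/50)\<^sup>2)\<^sup>2 + 2 * (69/50)\<^sup>2 * (y - 69/50)\<^sup>2" by simp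
  also have "\<dots> = y ^ 4 - 4 * (69/50) ^ 3 * y + 3 * (69/50) ^ 4"
    by (simp add: power2_eq_square power3_eq_cube power4_eq_xxxx algebra_simps)
  finally have "10512 * y \<le> 1000 * y ^ 4 + 108804/10"
    using y by (simp add: power3_eq_cube power4_eq_xxxx)
  \<comment> \<open>The minimum of the quadratic in \<open>y ^ 4\<close> lies at about 3.598,
    rounded to 18/5 for the square.\<close>
  moreover have "36840 * y ^ 4 \<le> 5120 * (y ^ 4)\<^sup>2 + 105120"
  proof -
    have "0 \<le> 5120 * (y ^ 4 - 18/5)\<^sup>2" by simp
    also have "\<dots> = 5120 * (y ^ 4)\<^sup>2 - 36864 * y ^ 4 + 5120 * (18/5)\<^sup>2"
      by (simp add: power2_eq_square algebra_simps)
    finally have "36864 * y ^ 4 \<le> 5120 * (y ^ 4)\<^sup>2 + 5120 * (18/5)\<^sup>2" by simp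
    moreover have "5120 * (18/5)\<^sup>2 \<le> (105120::real)" by (simp add: power2_eq_square)
    moreover have "y ^ 4 \<ge> 0" by simp
    ultimately show ?thesis by linarith
  qed
  ultimately have "10 * y * y ^ 4 \<le> (y ^ 4)\<^sup>2 + 10 * y ^ 4 + 1"
    using mult_right_mono[of "10512 * y" "1000 * y ^ 4 + 108804/10" "y ^ 4"]
    by (simp add: algebra_simps power2_eq_square)
  then have "y \<le> 1 + (y ^ 4 + inverse (y ^ 4)) / 10"
    using y by (simp add: field_simps power2_eq_square)
  moreover have "exp (4 * x) = y ^ 4"
    by (simp add: y_def flip: exp_of_nat_mult)
  ultimately show ?thesis
    by (simp add: cosh_def exp_minus y_def)
qed

text \<open>Exact to second order with a remainder that is even and increasing in
  \<open>\<bar>x\<bar>\<close>: it can be integrated for an unbounded sub-Gaussian variable, and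
  beyond the linear term a bound on \<open>\<bar>x\<bar>\<close> suffices. The difference of the two
  sides vanishes to first order at 0 and is convex, where 4^2 / 80 = 1/5.\<close>

lemma exp_le_taylor2_cosh:
  fixes x :: real
  shows "exp x \<le> 1 + x + x\<^sup>2 / 2 + (cosh (4 * x) - 1) / 80"
proof -
  define f where "f = (\<lambda>x::real. 1 + x + x\<^sup>2 / 2 + (cosh (4 * x) - 1) / 80 - exp x)"
  define f' where "f' = (\<lambda>x::real. 1 + x + sinh (4 * x) / 20 - exp x)"
  have "convex_on UNIV f"
  proof (rule f''_ge0_imp_convex)
    show "DERIV f x :> f' x" for x
      unfolding f_def f'_def by (auto intro!: derivative_eq_intros)
    show "DERIV f' x :> 1 + cosh (4 * x) / 5 - exp x" for x
      unfolding f'_def by (auto intro!: derivative_eq_intros)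
  qed (use exp_le_1_add_cosh_four in auto)
  then have "f x - f 0 \<ge> f' 0 * (x - 0)"
    by (rule convex_on_imp_above_tangent)
       (auto simp: f_def f'_def intro!: derivative_eq_intros)
  then show ?thesis by (simp add: f_def f'_def)
qed

lemma exp_le_two:
  fixes t b :: real
  assumes "\<bar>t\<bar> \<le> 3/5"
  shows "exp t \<le> 2"
proof -
  have "exp t \<le> exp (3/5)" using assms by simp
  also have "exp (3/5::real) \<le> 1 + 3/5 + (3/5)\<^sup>2"
    by (intro exp_bound) auto
  finally show ?thesis by (simp add: power2_eq_square)
qed

text \<open>The odd Taylor terms cancel between exp x and exp (-x). The range 3/5 is that of
  \<open>8 * p x\<close> when \<open>\<bar>p x\<bar>\<close> is at most 3/40.\<close>

lemma cosh_le_quadratic: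
  fixes x :: real
  assumes "\<bar>x\<bar> \<le> 3/5"
  shows "cosh x - 1 \<le> 14/25 * x\<^sup>2"
proof -
  have *: "exp y \<le> 1 + y + y\<^sup>2/2 + y^3/6 + x\<^sup>2 * (3/100)" if "y = x \<or> y = -x" for y
  proof -
    obtain t where t: "\<bar>t\<bar> \<le> \<bar>y\<bar>" "exp y = (\<Sum>m<4. (y ^ m) / fact m) + (exp t / fact 4) * y ^ 4"
      using Maclaurin_exp_le[of y 4] by blast
    have y2: "y\<^sup>2 = x\<^sup>2" using that by auto
    have "y ^ 4 = (x\<^sup>2)\<^sup>2" using that by auto
    also have "\<dots> \<le> x\<^sup>2 * (3/5)\<^sup>2"
      using assms abs_le_square_iff[of x "3/5"]
      by (subst power2_eq_square) (intro mult_left_mono, auto)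
    finally have "exp t * y ^ 4 \<le> 2 * (x\<^sup>2 * (3/5)\<^sup>2)"
      using exp_le_two[of t] t(1) that assms by (intro mult_mono) auto
    then have "(exp t / fact 4) * y ^ 4 \<le> x\<^sup>2 * (3/100)"
      by (simp add: fact_numeral power2_eq_square)
    then show ?thesis
      using t(2) by (simp add: eval_nat_numeral lessThan_Suc fact_numeral)
  qed
  have "exp x + exp (-x) \<le> 2 + 2 * (14/25 * x\<^sup>2)"
  proof -
    have "exp x \<le> 53/100 * x\<^sup>2 + (1 + (x + x^3/6))" using *[of x] by simp
    moreover have "exp (-x) \<le> 53/100 * x\<^sup>2 + (1 - (x + x^3/6))" using *[of "-x"] by simp
    ultimately show ?thesis using zero_le_power2[of x] by linarith
  qed
  then show ?thesis by (simp add: cosh_def field_simps)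
qed

text \<open>The range 4/15 is that of a product bounded by 4/3 \<xi> times the Chernoff parameter
  \<open>1 / (5 * \<xi>)\<close>.\<close>

lemma exp_le_quadratic:
  fixes x :: real
  assumes "\<bar>x\<bar> \<le> 4/15"
  shows "exp x \<le> 1 + x + 14/25 * x\<^sup>2"
proof -
  obtain t where t: "\<bar>t\<bar> \<le> \<bar>x\<bar>" "exp x = (\<Sum>m<3. (x ^ m) / fact m) + (exp t / fact 3) * x ^ 3"
    using Maclaurin_exp_le[of x 3] by blast
  have "exp t \<le> exp (4/15)" using t assms by simp
  also have "exp (4/15::real) \<le> 1 + 4/15 + (4/15)\<^sup>2"
    by (intro exp_bound) auto
  finally have e: "exp t \<le> 27/20" by (simp add: power2_eq_square)
  have "exp t * x ^ 3 \<le> exp t * (\<bar>x\<bar> * x\<^sup>2)"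
    by (intro mult_left_mono) (auto simp: power3_eq_cube power2_eq_square mult.assoc mult_right_mono)
  also have "\<dots> \<le> 27/20 * (4/15 * x\<^sup>2)"
    using e assms by (intro mult_mono) auto
  finally have "(exp t / fact 3) * x ^ 3 \<le> 3/50 * x\<^sup>2"
    by (simp add: fact_numeral)
  moreover have "(\<Sum>m<3. (x ^ m) / fact m) = 1 + x + x\<^sup>2 / 2"
    by (simp add: eval_nat_numeral lessThan_Suc fact_numeral)
  ultimately show ?thesis
    using t(2) zero_le_power2[of x] by linarith
qed

text \<open>A majorant with mean 1 + E Z + K suffices since 1 + s \<le> exp s at s = E Z + K;
  factoring out exp (- E Z) leaves exp K.\<close>

lemma (in prob_space) nn_integral_exp_centered_le:
  fixes Z :: "'a \<Rightarrow> real"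
  assumes Z: "Z \<in> borel_measurable M" and B: "integrable M B"
    and le: "\<And>x. x \<in> space M \<Longrightarrow> exp (Z x) \<le> B x"
    and int: "(\<integral>x. B x \<partial>M) \<le> 1 + (\<integral>x. Z x \<partial>M) + K"
  shows "(\<integral>\<^sup>+x. ennreal (exp (Z x - (\<integral>x. Z x \<partial>M))) \<partial>M) \<le> ennreal (exp K)"
proof -
  note [measurable] = Z
  let ?m = "\<integral>x. Z x \<partial>M"
  have "(\<integral>\<^sup>+x. ennreal (exp (Z x)) \<partial>M) \<le> (\<integral>\<^sup>+x. ennreal (B x) \<partial>M)"
    by (intro nn_integral_mono ennreal_leI le)
  also have "\<dots> = ennreal (\<integral>x. B x \<partial>M)"
    using le by (intro nn_integral_eq_integral B) (auto intro!: AE_I2 order_trans[OF exp_ge_zero])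
  also have "\<dots> \<le> ennreal (exp (?m + K))"
    using int exp_ge_add_one_self[of "?m + K"] by (intro ennreal_leI) linarith
  finally have *: "(\<integral>\<^sup>+x. ennreal (exp (Z x)) \<partial>M) \<le> ennreal (exp (?m + K))" .
  have "(\<integral>\<^sup>+x. ennreal (exp (Z x - ?m)) \<partial>M) = (\<integral>\<^sup>+x. ennreal (exp (- ?m)) * ennreal (exp (Z x)) \<partial>M)"
    by (simp add: exp_diff exp_minus divide_simps flip: ennreal_mult)
  also have "\<dots> = ennreal (exp (- ?m)) * (\<integral>\<^sup>+x. ennreal (exp (Z x)) \<partial>M)"
    by (intro nn_integral_cmult) auto
  also have "\<dots> \<le> ennreal (exp (- ?m)) * ennreal (exp (?m + K))"
    by (intro mult_left_mono *) auto
  also have "\<dots> = ennreal (exp K)" by (simp flip: ennreal_mult exp_add)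
  finally show ?thesis .
qed

lemma (in prob_space) mgf_bounded_le:
  fixes Y :: "'a \<Rightarrow> real"
  assumes Y: "Y \<in> borel_measurable M" and b: "\<And>x. x \<in> space M \<Longrightarrow> \<bar>t * Y x\<bar> \<le> 4/15"
    and V: "(\<integral>x. (t * Y x)\<^sup>2 \<partial>M) \<le> V"
  shows "(\<integral>\<^sup>+x. ennreal (exp (t * (Y x - (\<integral>x. Y x \<partial>M)))) \<partial>M) \<le> ennreal (exp (14/25 * V))"
proof -
  note [measurable] = Y
  have I1: "integrable M (\<lambda>x. t * Y x)"
    using b by (intro integrable_const_bound[where B = "4/15"]) (auto intro!: AE_I2)
  have I2: "integrable M (\<lambda>x. (t * Y x)\<^sup>2)"
  proof (rule integrable_const_bound[where B = "(4/15)\<^sup>2"])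
    show "AE x in M. norm ((t * Y x)\<^sup>2) \<le> (4/15)\<^sup>2"
    proof (rule AE_I2)
      fix x assume "x \<in> space M"
      from power_mono[OF b[OF this], of 2] show "norm ((t * Y x)\<^sup>2) \<le> (4/15)\<^sup>2" by simp
    qed
  qed simp
  have "(\<integral>\<^sup>+x. ennreal (exp (t * Y x - (\<integral>x. t * Y x \<partial>M))) \<partial>M) \<le> ennreal (exp (14/25 * V))"
  proof (rule nn_integral_exp_centered_le[where B = "\<lambda>x. 1 + t * Y x + 14/25 * (t * Y x)\<^sup>2"])
    show "(\<integral>x. 1 + t * Y x + 14/25 * (t * Y x)\<^sup>2 \<partial>M) \<le> 1 + (\<integral>x. t * Y x \<partial>M) + 14/25 * V"
      using I1 I2 V by (simp add: prob_space)
  qed (use I1 I2 exp_le_quadratic b in auto)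
  then show ?thesis by (simp add: right_diff_distrib)
qed

lemma (in prob_space) subgaussian_cosh:
  assumes q: "subgaussian M W q" and [measurable]: "q \<in> borel_measurable M"
  shows "integrable M (\<lambda>x. cosh (l * q x))"
    and "(\<integral>x. cosh (l * q x) \<partial>M) \<le> exp (l\<^sup>2 * W / 2)"
proof -
  have "integrable M (\<lambda>x. exp (l * q x)) \<and> (\<integral>x. exp (l * q x) \<partial>M) \<le> exp (l\<^sup>2 * W / 2)" for l
  proof -
    have le: "(\<integral>\<^sup>+x. ennreal (exp (l * q x)) \<partial>M) \<le> ennreal (exp (l\<^sup>2 * W / 2))"
      using q by (auto simp: subgaussian_def)
    have I: "integrable M (\<lambda>x. exp (l * q x))"
      using le by (intro integrableI_nonneg) (auto intro: le_less_trans)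
    then show ?thesis
      using le by (simp add: nn_integral_eq_integral[OF I])
  qed
  from this[of l] this[of "-l"] show "integrable M (\<lambda>x. cosh (l * q x))"
    "(\<integral>x. cosh (l * q x) \<partial>M) \<le> exp (l\<^sup>2 * W / 2)"
    by (simp_all add: cosh_def)
qed

lemma square_le_cosh: "y\<^sup>2 \<le> 2 * (cosh y - 1)" for y :: real
proof -
  have *: "exp z \<ge> 1 + z + z\<^sup>2/2 + z^3/6" for z :: real
  proof -
    obtain t where "exp z = (\<Sum>m<4. (z ^ m) / fact m) + (exp t / fact 4) * z ^ 4"
      using Maclaurin_exp_le[of z 4] by blast
    moreover have "(\<Sum>m<4. (z ^ m) / fact m) = 1 + z + z\<^sup>2/2 + z^3/6"
      by (simp add: eval_nat_numeral lessThan_Suc fact_numeral)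
    moreover have "(exp t / fact 4) * z ^ 4 \<ge> 0" by simp
    ultimately show ?thesis by linarith
  qed
  show ?thesis using *[of y] *[of "-y"] by (simp add: cosh_def field_simps)
qed

text \<open>The square is dominated by 2 (cosh - 1), whose mean is controlled by the moment
  generating function at 1 and -1. To first order the bound is \<open>W\<close> itself, so for small
  \<open>W\<close> hardly anything is lost.\<close>

lemma (in prob_space) subgaussian_square:
  assumes q: "subgaussian M W q" and [measurable]: "q \<in> borel_measurable M"
  shows "integrable M (\<lambda>x. (q x)\<^sup>2)" and "(\<integral>x. (q x)\<^sup>2 \<partial>M) \<le> 2 * (exp (W / 2) - 1)"
proof -
  note cosh_q = subgaussian_cosh[OF assms]
  show q2: "integrable M (\<lambda>x. (q x)\<^sup>2)"
    by (rule Bochner_Integration.integrable_bound[where f = "\<lambda>x. 2 * (cosh (1 * q x) - 1)"])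
       (use cosh_q(1)[of 1] square_le_cosh in \<open>auto intro!: AE_I2 intro: order_trans[OF _ abs_ge_self]\<close>)
  show "(\<integral>x. (q x)\<^sup>2 \<partial>M) \<le> 2 * (exp (W / 2) - 1)"
  proof -
    have "(\<integral>x. (q x)\<^sup>2 \<partial>M) \<le> (\<integral>x. 2 * (cosh (1 * q x) - 1) \<partial>M)"
      using square_le_cosh cosh_q(1)[of 1] by (intro integral_mono q2) auto
    also have "\<dots> \<le> 2 * (exp (W / 2) - 1)"
      using cosh_q[of 1] by (simp add: prob_space)
    finally show ?thesis .
  qed
qed

text \<open>The bound on \<open>Z\<close> is kept as \<open>\<bar>p - q\<bar>\<close>, not \<open>\<bar>p\<bar> + \<bar>q\<bar>\<close>: by orthogonality the second moments of \<open>p\<close>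
  and \<open>q\<close> then just add up.\<close>
lemma (in prob_space) mgf_subgaussian_mix_le:
  fixes Z p q :: "'a \<Rightarrow> real"
  assumes [measurable]: "Z \<in> borel_measurable M" "p \<in> borel_measurable M" "q \<in> borel_measurable M"
    and Z: "\<And>x. x \<in> space M \<Longrightarrow> \<bar>Z x\<bar> \<le> \<bar>p x - q x\<bar>"
    and p: "\<And>x. x \<in> space M \<Longrightarrow> \<bar>p x\<bar> \<le> 3/40"
    and q: "subgaussian M W q" and W: "0 \<le> W" "W \<le> 1/128"
    and orth: "(\<integral>x. p x * q x \<partial>M) = 0"
  shows "(\<integral>\<^sup>+x. ennreal (exp (Z x - (\<integral>x. Z x \<partial>M))) \<partial>M)
           \<le> ennreal (exp (753/1000 * ((\<integral>x. (p x)\<^sup>2 \<partial>M) + W)))"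
proof -
  note cosh_q = subgaussian_cosh[OF q \<open>q \<in> borel_measurable M\<close>]
  note q2 = subgaussian_square(1)[OF q \<open>q \<in> borel_measurable M\<close>]
  note q2_le = subgaussian_square(2)[OF q \<open>q \<in> borel_measurable M\<close>]
  have q1: "integrable M q" by (rule square_integrable_imp_integrable[OF _ q2]) simp
  have p1: "integrable M p"
    using p by (intro integrable_const_bound[where B = "3/40"]) (auto intro!: AE_I2)
  have p2: "integrable M (\<lambda>x. (p x)\<^sup>2)"
  proof (rule Bochner_Integration.integrable_bound[of _ "\<lambda>x. (3/40)\<^sup>2 :: real"])
    show "AE x in M. norm ((p x)\<^sup>2) \<le> norm ((3/40)\<^sup>2 :: real)"
      using power_mono[OF p, of _ 2] by (auto intro!: AE_I2)
  qed auto
  have pq: "integrable M (\<lambda>x. p x * q x)"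
  proof (rule Bochner_Integration.integrable_bound[OF q1])
    show "AE x in M. norm (p x * q x) \<le> norm (q x)"
    proof (rule AE_I2)
      fix x assume "x \<in> space M"
      then show "norm (p x * q x) \<le> norm (q x)"
        unfolding norm_mult using p[of x] by (intro mult_left_le_one_le) auto
    qed
  qed simp
  have Z1: "integrable M Z"
    using Z by (intro Bochner_Integration.integrable_bound[OF Bochner_Integration.integrable_diff[OF p1 q1]])
      (auto intro!: AE_I2)
  have cosh_p: "cosh (8 * p x) - 1 \<le> 36 * (p x)\<^sup>2" if "x \<in> space M" for x
  proof -
    have "\<bar>8 * p x\<bar> \<le> 3/5" using p[OF that] by (simp add: abs_mult)
    from cosh_le_quadratic[OF this] have "cosh (8 * p x) - 1 \<le> 896/25 * (p x)\<^sup>2"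
      by (simp add: power_mult_distrib)
    also have "\<dots> \<le> 36 * (p x)\<^sup>2" by (intro mult_right_mono) auto
    finally show ?thesis .
  qed
  \<comment> \<open>Splitting p - q by convexity doubles the argument to 8. Only the remainder is
    split this way; the quadratic term keeps the difference.\<close>
  have cosh_Z: "cosh (4 * Z x) \<le> (cosh (8 * p x) + cosh (8 * q x)) / 2" if "x \<in> space M" for x
  proof -
    have "cosh (4 * Z x) = cosh \<bar>4 * Z x\<bar>" by (auto simp: abs_if)
    also have "\<dots> \<le> cosh \<bar>4 * (p x - q x)\<bar>"
      using Z[OF that] by (subst cosh_real_nonneg_le_iff) auto
    also have "\<dots> = cosh (4 * (p x - q x))" by (auto simp: abs_if)
    also have "\<dots> \<le> (cosh (8 * p x) + cosh (8 * q x)) / 2"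
    proof -
      have *: "exp (a + b) \<le> (exp (2 * a) + exp (2 * b)) / 2" for a b :: real
      proof -
        have "0 \<le> (exp a - exp b)\<^sup>2" by simp
        moreover have "exp (2 * z) = exp z * exp z" for z :: real by (simp flip: exp_add)
        ultimately show ?thesis
          by (simp add: exp_add power2_eq_square algebra_simps)
      qed
      show ?thesis
        using *[of "4 * p x" "- 4 * q x"] *[of "- 4 * p x" "4 * q x"]
        by (simp add: cosh_def algebra_simps)
    qed
    finally show ?thesis .
  qed
  \<comment> \<open>The last denominator is 80 * 2, from the Taylor remainder and the convex
    splitting. The cross term is kept, to vanish on integration.\<close>
  define B where "B = (\<lambda>x. 1 + Z x + ((p x)\<^sup>2 + (q x)\<^sup>2 - 2 * (p x * q x)) / 2
      + (36 * (p x)\<^sup>2 + (cosh (8 * q x) - 1)) / 160)"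
  have "exp (Z x) \<le> B x" if "x \<in> space M" for x
  proof -
    have "(Z x)\<^sup>2 \<le> (p x - q x)\<^sup>2"
      using Z[OF that] by (simp add: abs_le_square_iff)
    then show ?thesis
      using exp_le_taylor2_cosh[of "Z x"] cosh_Z[OF that] cosh_p[OF that]
      by (simp add: B_def power2_diff field_simps)
  qed
  moreover have IB: "integrable M B"
    unfolding B_def using Z1 p2 q2 pq cosh_q(1)[of 8] by simp
  \<comment> \<open>The second moment of \<open>p\<close> receives 1/2 + 36/160 = 0.725 and
    \<open>W\<close> receives 257/512 + 40/160 < 0.752; 753/1000 covers both.\<close>
  moreover have "(\<integral>x. B x \<partial>M) \<le> 1 + (\<integral>x. Z x \<partial>M) + 753/1000 * ((\<integral>x. (p x)\<^sup>2 \<partial>M) + W)"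
  proof -
    define EP EQ EC where "EP = (\<integral>x. (p x)\<^sup>2 \<partial>M)" and "EQ = (\<integral>x. (q x)\<^sup>2 \<partial>M)"
      and "EC = (\<integral>x. cosh (8 * q x) \<partial>M)"
    have EB: "(\<integral>x. B x \<partial>M) = 1 + (\<integral>x. Z x \<partial>M) + (EP + EQ) / 2 + (36 * EP + (EC - 1)) / 160"
      unfolding B_def EP_def EQ_def EC_def
      using Z1 p2 q2 pq cosh_q(1)[of 8] by (simp add: prob_space orth)
    have W2: "W\<^sup>2 \<le> W * (1/128)"
      unfolding power2_eq_square using W by (intro mult_left_mono) auto
    have "exp (W / 2) \<le> 1 + W / 2 + (W / 2)\<^sup>2" using W by (intro exp_bound) auto
    then have EQ: "EQ \<le> 257/256 * W" using q2_le W2 by (simp add: EQ_def power_divide)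
    have "exp (32 * W) \<le> 1 + 32 * W + (32 * W)\<^sup>2" using W by (intro exp_bound) auto
    then have EC: "EC - 1 \<le> 40 * W"
      using cosh_q(2)[of 8] W2 by (simp add: EC_def power_mult_distrib)
    have "EP \<ge> 0" by (simp add: EP_def)
    then show ?thesis using EQ EC W by (simp add: EB EP_def[symmetric] add_divide_distrib diff_divide_distrib distrib_left)
  qed
  ultimately show ?thesis by (intro nn_integral_exp_centered_le[of Z B]) auto
qed

text \<open>Negative parameters reduce to positive ones through \<open>- Y\<close>. The interval
  [-b, b] has length 2 b, which turns the Hoeffding exponent l^2 (2 b)^2 / 8 into l^2 b^2 /
  2.\<close>

lemma (in prob_space) mgf_hoeffding_le:
  fixes Y :: "'a \<Rightarrow> real"
  assumes Y: "Y \<in> borel_measurable M" and b: "\<And>x. x \<in> space M \<Longrightarrow> \<bar>Y x\<bar> \<le> b"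
    and EY: "(\<integral>x. Y x \<partial>M) = 0" and l: "l \<noteq> 0"
  shows "(\<integral>\<^sup>+x. ennreal (exp (l * Y x)) \<partial>M) \<le> ennreal (exp (l\<^sup>2 * b\<^sup>2 / 2))"
proof -
  have *: "(\<integral>\<^sup>+x. ennreal (exp (l * Y x)) \<partial>M) \<le> ennreal (exp (l\<^sup>2 * b\<^sup>2 / 2))"
    if "l > 0" "Y \<in> borel_measurable M" "\<And>x. x \<in> space M \<Longrightarrow> \<bar>Y x\<bar> \<le> b" "(\<integral>x. Y x \<partial>M) = 0" for l Y
  proof -
    interpret interval_bounded_random_variable M Y "-b" b
      using that by unfold_locales (auto intro!: AE_I2 simp: abs_le_iff minus_le_iff)
    have "(b - - b)\<^sup>2 = 4 * b\<^sup>2" by (simp add: power2_eq_square)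
    then show ?thesis using Hoeffdings_lemma_nn_integral_0[OF \<open>l > 0\<close>] that(4) by (simp add: mult.commute)
  qed
  show ?thesis
    using *[of l Y] *[of "-l" "\<lambda>x. - Y x"] assms by (cases "l > 0") auto
qed

text \<open>Independence enters through the product measure: the exponential of the sum is a product
  over coordinates, so its integral factorizes.\<close>

lemma prob_iid_sum_ge:
  fixes g :: "'a \<Rightarrow> real"
  assumes "prob_space M" and g: "g \<in> borel_measurable M" and "t > 0"
    and mgf: "(\<integral>\<^sup>+ x. ennreal (exp (t * g x)) \<partial>M) \<le> ennreal (exp K)"
  shows "measure (PiM {..<n} (\<lambda>_. M)) {X \<in> space (PiM {..<n} (\<lambda>_. M)). real n * c \<le> (\<Sum>k<n. g (X k))}
           \<le> exp (real n * (K - t * c))"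
proof -
  interpret M: prob_space M by fact
  interpret P: product_prob_space "\<lambda>_. M" "{..<n}" by unfold_locales
  let ?P = "PiM {..<n} (\<lambda>_. M)"
  note [measurable] = g
  have "ennreal (measure ?P {X \<in> space ?P. real n * c \<le> (\<Sum>k<n. g (X k))})
      = emeasure ?P {X \<in> space ?P. real n * c \<le> (\<Sum>k<n. g (X k))}"
    by (simp add: P.emeasure_eq_measure)
  also have "\<dots> \<le> ennreal (exp (- t * (real n * c))) * (\<integral>\<^sup>+X\<in>space ?P. ennreal (exp (t * (\<Sum>k<n. g (X k)))) \<partial>?P)"
    by (intro Chernoff_ineq_nn_integral_ge \<open>t > 0\<close>) auto
  also have "(\<integral>\<^sup>+X\<in>space ?P. ennreal (exp (t * (\<Sum>k<n. g (X k)))) \<partial>?P)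
      = (\<integral>\<^sup>+X. (\<Prod>k<n. ennreal (exp (t * g (X k)))) \<partial>?P)"
    by (intro nn_integral_cong) (simp add: sum_distrib_left exp_sum prod_ennreal)
  also have "\<dots> = (\<Prod>k<n. \<integral>\<^sup>+x. ennreal (exp (t * g x)) \<partial>M)"
    by (intro P.product_nn_integral_prod) auto
  also have "\<dots> \<le> (\<Prod>k<n. ennreal (exp K))"
    by (intro prod_mono_ennreal mgf)
  also have "\<dots> = ennreal (exp K ^ n)" by (simp add: ennreal_power)
  also have "ennreal (exp (- t * (real n * c))) * ennreal (exp K ^ n) = ennreal (exp (real n * (K - t * c)))"
    by (simp add: algebra_simps exp_diff exp_minus exp_of_nat_mult[symmetric] divide_simps flip: ennreal_mult exp_add)
  finally show ?thesis
    by (simp add: mult_left_mono)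
qed

lemma chernoff_union:
  fixes g :: "'i \<Rightarrow> 'a \<Rightarrow> real"
  assumes M: "prob_space M" and I: "finite I" and n: "n > 0" and t: "t > 0"
    and g: "\<And>i. i \<in> I \<Longrightarrow> g i \<in> borel_measurable M"
    and mgf: "\<And>i s. i \<in> I \<Longrightarrow> s = t \<or> s = -t \<Longrightarrow>
                (\<integral>\<^sup>+ x. ennreal (exp (s * g i x)) \<partial>M) \<le> ennreal (exp K)"
  shows "\<exists>E \<in> sets (PiM {..<n} (\<lambda>_. M)).
           measure (PiM {..<n} (\<lambda>_. M)) E \<ge> 1 - 2 * real (card I) * exp (real n * (K - t * c)) \<and>
           (\<forall>X\<in>E. \<forall>i\<in>I. \<bar>emp_mean n X (g i)\<bar> < c)"
proof -
  interpret M: prob_space M by fact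
  interpret P: product_prob_space "\<lambda>_. M" "{..<n}" by unfold_locales
  let ?P = "PiM {..<n} (\<lambda>_. M)"
  define B where "B = (\<lambda>(i, s). {X \<in> space ?P. real n * c \<le> (\<Sum>k<n. s * g i (X k))})"
  \<comment> \<open>The second component is a sign; covering both tails costs the factor 2.\<close>
  define J where "J = I \<times> {1, -1::real}"
  have J: "finite J" "card J = 2 * card I" using I by (auto simp: J_def card_cartesian_product)
  have B_sets: "B j \<in> sets ?P" if "j \<in> J" for j
    using that g unfolding B_def J_def by (auto split: prod.splits)
  have B_le: "measure ?P (B j) \<le> exp (real n * (K - t * c))" if jJ: "j \<in> J" for j
  proof -
    obtain i s where j: "j = (i, s)" "i \<in> I" "s = 1 \<or> s = -1" using jJ by (auto simp: J_def)
    have gi: "g i \<in> borel_measurable M" using g j by auto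
    have "(\<integral>\<^sup>+ x. ennreal (exp (t * (s * g i x))) \<partial>M) \<le> ennreal (exp K)"
      using mgf[OF \<open>i \<in> I\<close>, of "t * s"] j by (auto simp: mult.assoc)
    from prob_iid_sum_ge[OF M _ t this, of n c] gi
    show ?thesis by (simp add: j B_def)
  qed
  define E where "E = space ?P - (\<Union>j\<in>J. B j)"
  have U: "(\<Union>j\<in>J. B j) \<in> sets ?P" using J B_sets by (intro sets.finite_UN) auto
  have "measure ?P (\<Union>j\<in>J. B j) \<le> (\<Sum>j\<in>J. measure ?P (B j))"
    using J B_sets by (intro P.finite_measure_subadditive_finite) auto
  also have "\<dots> \<le> (\<Sum>j\<in>J. exp (real n * (K - t * c)))"
    by (intro sum_mono B_le)
  finally have "measure ?P (\<Union>j\<in>J. B j) \<le> 2 * real (card I) * exp (real n * (K - t * c))"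
    using J by simp
  moreover have "measure ?P E = 1 - measure ?P (\<Union>j\<in>J. B j)"
    unfolding E_def by (rule P.prob_compl[OF U])
  moreover have "\<bar>emp_mean n X (g i)\<bar> < c" if "X \<in> E" "i \<in> I" for X i
  proof -
    have "X \<in> space ?P" "X \<notin> B (i, 1)" "X \<notin> B (i, -1)"
      using that by (auto simp: E_def J_def)
    then have "(\<Sum>k<n. g i (X k)) < real n * c" "- (\<Sum>k<n. g i (X k)) < real n * c"
      by (auto simp: B_def sum_negf not_le)
    then show ?thesis using n by (auto simp: emp_mean_def abs_less_iff field_simps)
  qed
  moreover have "E \<in> sets ?P" unfolding E_def using U by auto
  ultimately show ?thesis by (intro bexI[of _ E]) auto
qed

section \<open>Dual certificates\<close>

text \<open>Dividing by \<open>\<bar>e\<bar>\<close> and letting e tend to 0 from either side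
  removes the quadratic term. This extracts first-order optimality conditions: c = 0 along smooth
  directions, c > 0 at a kink of an l1 term.\<close>

lemma abs_coeff_le_if_nonneg_near_0:
  fixes a b c :: real
  assumes "\<And>e. \<bar>e\<bar> \<le> 1 \<Longrightarrow> 0 \<le> a * e + b * e\<^sup>2 + c * \<bar>e\<bar>"
  shows "\<bar>a\<bar> \<le> c"
proof (rule field_le_epsilon)
  fix d :: real assume d: "d > 0"
  define \<eta> where "\<eta> = min 1 (d / (\<bar>b\<bar> + 1))"
  have \<eta>: "\<eta> > 0" "\<eta> \<le> 1" "\<eta> \<le> d / (\<bar>b\<bar> + 1)" using d by (auto simp: \<eta>_def)
  then have "\<eta> * (\<bar>b\<bar> + 1) \<le> d" by (simp add: pos_le_divide_eq add_nonneg_pos)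
  then have b: "b * \<eta> \<le> d"
    using \<eta> by (smt (verit, best) mult.commute mult_left_mono)
  have *: "s * a \<le> c + d" if "s = 1 \<or> s = -1" for s :: real
  proof -
    have "0 \<le> a * (- s * \<eta>) + b * (- s * \<eta>)\<^sup>2 + c * \<bar>- s * \<eta>\<bar>"
      using \<eta> that by (intro assms) auto
    also have "\<dots> = \<eta> * (- s * a + b * \<eta> + c)"
      using \<eta> that by (auto simp: power2_eq_square algebra_simps)
    finally have "0 \<le> - s * a + b * \<eta> + c" using \<eta> by (simp add: zero_le_mult_iff)
    then show ?thesis using b by auto
  qed
  show "\<bar>a\<bar> \<le> c + d" using *[of 1] *[of "-1"] by auto
qed

lemma sum_abs_squared_le_card_mult_norm:
  fixes w :: "real^'m::finite"
  shows "(\<Sum>j\<in>S. \<bar>w$j\<bar>)\<^sup>2 \<le> real (card S) * (norm w)\<^sup>2"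
proof -
  have "(\<Sum>j\<in>S. \<bar>w$j\<bar>)\<^sup>2 \<le> (\<Sum>j\<in>S. \<bar>w$j\<bar>\<^sup>2) * real (card S)"
    by (rule sum_squared_le_sum_of_squares)
  also have "(\<Sum>j\<in>S. \<bar>w$j\<bar>\<^sup>2) \<le> (\<Sum>j\<in>UNIV. (w$j)\<^sup>2)"
    by (simp add: sum_mono2)
  also have "\<dots> = (norm w)\<^sup>2"
    unfolding power2_norm_eq_inner by (simp add: inner_vec_def power2_eq_square)
  finally show ?thesis by (simp add: mult.commute mult_right_mono)
qed

text \<open>Optimality along coordinate axes gives the two gradient conditions; optimality along
  \<open>v\<close> itself gives q v = T v - r v / 3. Cauchy-Schwarz on S and the restricted
  eigenvalue condition add (a v)^2 \<le> z q v with z = |S| / \<gamma>, and both size bounds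
  follow.\<close>

lemma dual_certificate:
  fixes G :: "'m::finite \<Rightarrow> 'm \<Rightarrow> real" and \<theta> :: "'m \<Rightarrow> real"
  defines "q \<equiv> \<lambda>u::real^'m. \<Sum>j\<in>UNIV. \<Sum>k\<in>UNIV. u$j * G j k * u$k"
  assumes sym: "\<And>j k. G j k = G k j" and psd: "\<And>u. 0 \<le> q u"
    and RE: "\<And>u. u \<in> cone_set S 3 \<Longrightarrow> q u \<ge> \<gamma> * (norm u)\<^sup>2"
    and \<gamma>: "\<gamma> > 0" and S: "S \<noteq> {}" and \<theta>: "\<And>j. j \<in> S \<Longrightarrow> \<bar>\<theta> j\<bar> \<le> 1"
  obtains v :: "real^'m"
  where "\<And>j. j \<in> S \<Longrightarrow> (\<Sum>k\<in>UNIV. G j k * v$k) = \<theta> j"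
    and "\<And>j. j \<notin> S \<Longrightarrow> \<bar>\<Sum>k\<in>UNIV. G j k * v$k\<bar> \<le> 1/3"
    and "q v \<le> real (card S) / \<gamma>" and "(\<Sum>j\<in>UNIV. \<bar>v$j\<bar>) \<le> 4/3 * (real (card S) / \<gamma>)"
proof -
  define l where "l = real (card S)"
  have l: "l > 0" using S by (simp add: l_def card_gt_0_iff)
  define a where "a = (\<lambda>w::real^'m. \<Sum>j\<in>S. \<bar>w$j\<bar>)"
  define r where "r = (\<lambda>w::real^'m. \<Sum>j\<in>UNIV - S. \<bar>w$j\<bar>)"
  define T where "T = (\<lambda>w::real^'m. \<Sum>j\<in>S. \<theta> j * w$j)"
  define F where "F = (\<lambda>w. q w / 2 - T w + r w / 3)"
  have a0: "a w \<ge> 0" and r0: "r w \<ge> 0" for w by (auto simp: a_def r_def intro: sum_nonneg)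
  have T_le: "T w \<le> a w" for w
    unfolding T_def a_def
  proof (rule sum_mono)
    fix j assume "j \<in> S"
    then have "\<bar>\<theta> j * w$j\<bar> \<le> 1 * \<bar>w$j\<bar>" unfolding abs_mult by (intro mult_right_mono \<theta>) auto
    then show "\<theta> j * w$j \<le> \<bar>w$j\<bar>" by linarith
  qed
  have a_le: "(a w)\<^sup>2 \<le> l * (norm w)\<^sup>2" for w
    unfolding a_def l_def by (rule sum_abs_squared_le_card_mult_norm)
  have cone: "w \<in> cone_set S 3" if "r w \<le> 3 * a w" for w
    using that by (simp add: cone_set_def a_def r_def)
  have cont: "continuous_on A F" for A
    unfolding F_def q_def T_def r_def by (intro continuous_intros) auto
  \<comment> \<open>Coercivity is available only on the cone, so compactness is shown for this
    sublevel set. It contains 0, hence the minimum over it is global.\<close>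
  define L where "L = {w. F w \<le> 0}"
  have "bounded L"
  proof (rule boundedI)
    fix w assume "w \<in> L"
    then have Fw: "q w / 2 + r w / 3 \<le> a w" using T_le[of w] by (simp add: L_def F_def)
    then have "r w \<le> 3 * a w" using psd[of w] by linarith
    from RE[OF cone[OF this]] have "\<gamma> * (norm w)\<^sup>2 \<le> 2 * a w"
      using Fw r0[of w] by linarith
    also have "a w \<le> sqrt l * norm w"
      by (rule power2_le_imp_le) (use a_le[of w] l in \<open>auto simp: power_mult_distrib\<close>)
    finally have "(\<gamma> * norm w) * norm w \<le> (2 * sqrt l) * norm w"
      by (simp add: power2_eq_square)
    then have "\<gamma> * norm w \<le> 2 * sqrt l \<or> norm w = 0"
      by (metis mult_le_cancel_right_pos norm_ge_zero order_le_less)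
    then show "norm w \<le> 2 * sqrt l / \<gamma>" using \<gamma> l by (auto simp: field_simps)
  qed
  moreover have "closed L" unfolding L_def
    using cont[of UNIV] by (intro closed_Collect_le) auto
  ultimately have "compact L" by (simp add: compact_eq_bounded_closed)
  moreover have "0 \<in> L" by (simp add: L_def F_def q_def T_def r_def)
  ultimately obtain v where v: "v \<in> L" "\<And>w. w \<in> L \<Longrightarrow> F v \<le> F w"
    using continuous_attains_inf[of L F] cont by blast
  have min: "F v \<le> F w" for w
    using v by (cases "w \<in> L") (auto simp: L_def)
  define g where "g = (\<lambda>j. \<Sum>k\<in>UNIV. G j k * v$k)"
  have q_add: "q (v + e *\<^sub>R d) = q v + 2 * e * (\<Sum>j\<in>UNIV. d$j * g j) + e\<^sup>2 * q d" for e d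
  proof -
    have "(\<Sum>j\<in>UNIV. \<Sum>k\<in>UNIV. v$j * G j k * d$k) = (\<Sum>k\<in>UNIV. \<Sum>j\<in>UNIV. d$k * G k j * v$j)"
      by (subst sum.swap) (simp add: sym algebra_simps)
    then have "(\<Sum>j\<in>UNIV. \<Sum>k\<in>UNIV. v$j * G j k * d$k) = (\<Sum>j\<in>UNIV. d$j * g j)"
      by (simp add: g_def sum_distrib_left mult.assoc)
    moreover have "(\<Sum>j\<in>UNIV. \<Sum>k\<in>UNIV. d$j * G j k * v$k) = (\<Sum>j\<in>UNIV. d$j * g j)"
      by (simp add: g_def sum_distrib_left mult.assoc)
    moreover have "q (v + e *\<^sub>R d) = q v + e * (\<Sum>j\<in>UNIV. \<Sum>k\<in>UNIV. v$j * G j k * d$k)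
        + e * (\<Sum>j\<in>UNIV. \<Sum>k\<in>UNIV. d$j * G j k * v$k) + e\<^sup>2 * q d"
      by (simp add: q_def sum_distrib_left sum.distrib algebra_simps power2_eq_square)
    ultimately show ?thesis by simp
  qed
  have T_add: "T (v + e *\<^sub>R d) = T v + e * T d" for e d
    by (simp add: T_def algebra_simps sum.distrib sum_distrib_left)
  \<comment> \<open>All terms are polynomial in \<open>e\<close> except the increment of
    \<open>r\<close>, which is left exact so that each direction can treat it separately.\<close>
  have step: "0 \<le> ((\<Sum>j\<in>UNIV. d$j * g j) - T d) * e + (q d / 2) * e\<^sup>2 + (r (v + e *\<^sub>R d) - r v) / 3" for e d
    using min[of "v + e *\<^sub>R d"] by (simp add: F_def q_add T_add field_simps)
  have axis_g: "(\<Sum>k\<in>UNIV. axis j 1 $ k * g k) = g j" for j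
    by (simp add: axis_def if_distrib[of "\<lambda>x. x * _"] cong: if_cong)
  have gS: "g j = \<theta> j" if "j \<in> S" for j
  proof -
    have T: "T (axis j 1) = \<theta> j"
      using that by (simp add: T_def axis_def if_distrib[of "\<lambda>x. _ * x"] cong: if_cong)
    have "r (v + e *\<^sub>R axis j 1) = r v" for e
      unfolding r_def using that by (intro sum.cong) (auto simp: axis_def)
    then have "\<bar>g j - \<theta> j\<bar> \<le> 0"
      using step[of "axis j 1"]
      by (intro abs_coeff_le_if_nonneg_near_0[where b = "q (axis j 1) / 2"]) (simp add: T axis_g)
    then show ?thesis by simp
  qed
  have gSc: "\<bar>g j\<bar> \<le> 1/3" if "j \<notin> S" for j
  proof -
    have T: "T (axis j 1) = 0"
      unfolding T_def using that by (intro sum.neutral) (auto simp: axis_def)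
    have "r (v + e *\<^sub>R axis j 1) \<le> r v + \<bar>e\<bar>" for e
    proof -
      have "r (v + e *\<^sub>R axis j 1) \<le> (\<Sum>k\<in>UNIV - S. \<bar>v$k\<bar> + (if k = j then \<bar>e\<bar> else 0))"
        unfolding r_def by (intro sum_mono) (auto simp: axis_def)
      also have "\<dots> = r v + \<bar>e\<bar>" using that by (simp add: sum.distrib r_def)
      finally show ?thesis .
    qed
    note r_le = this
    have "0 \<le> g j * e + (q (axis j 1) / 2) * e\<^sup>2 + 1/3 * \<bar>e\<bar>" for e
    proof -
      have "0 \<le> g j * e + (q (axis j 1) / 2) * e\<^sup>2 + (r (v + e *\<^sub>R axis j 1) - r v) / 3"
        using step[of "axis j 1" e] unfolding T axis_g diff_0_right .
      moreover have "(r (v + e *\<^sub>R axis j 1) - r v) / 3 \<le> 1/3 * \<bar>e\<bar>"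
        using r_le[of e] by simp
      ultimately show ?thesis by (rule order_trans[OF _ add_left_mono])
    qed
    then show ?thesis by (intro abs_coeff_le_if_nonneg_near_0) blast
  qed
  have "(\<Sum>j\<in>UNIV. v$j * g j) = q v"
    by (simp add: q_def g_def sum_distrib_left mult.assoc)
  \<comment> \<open>Along \<open>v\<close> itself the kinks of \<open>r\<close> are not crossed,
    because 1 + e \<ge> 0; optimality is therefore an equality.\<close>
  moreover have "r (v + e *\<^sub>R v) = r v + e * r v" if "\<bar>e\<bar> \<le> 1" for e
  proof -
    have "\<bar>v$k + e * v$k\<bar> = (1 + e) * \<bar>v$k\<bar>" for k
    proof -
      have "v$k + e * v$k = (1 + e) * v$k" by (simp add: algebra_simps)
      then show ?thesis using that by (simp add: abs_mult)
    qed
    then show ?thesis by (simp add: r_def sum.distrib sum_distrib_left algebra_simps)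
  qed
  ultimately have "0 \<le> (q v - T v + r v / 3) * e + (q v / 2) * e\<^sup>2 + 0 * \<bar>e\<bar>" if "\<bar>e\<bar> \<le> 1" for e
    using step[where d = v and e = e] that by (simp add: algebra_simps)
  then have "\<bar>q v - T v + r v / 3\<bar> \<le> 0"
    by (rule abs_coeff_le_if_nonneg_near_0)
  then have Q: "q v = T v - r v / 3" by simp
  then have Q_le: "q v \<le> a v - r v / 3" using T_le[of v] by simp
  then have r_le: "r v \<le> 3 * a v" using psd[of v] by linarith
  have Q_ge: "\<gamma> * (a v)\<^sup>2 \<le> l * q v"
  proof -
    have "\<gamma> * (a v)\<^sup>2 \<le> \<gamma> * (l * (norm v)\<^sup>2)" using a_le \<gamma> by (intro mult_left_mono) auto
    also have "\<dots> = l * (\<gamma> * (norm v)\<^sup>2)" by simp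
    also have "\<dots> \<le> l * q v" using RE[OF cone[OF r_le]] l by (intro mult_left_mono) auto
    finally show ?thesis .
  qed
  define z where "z = l / \<gamma>"
  have z: "z > 0" and l_eq: "l = z * \<gamma>" using l \<gamma> by (auto simp: z_def)
  have Q_ge': "(a v)\<^sup>2 \<le> z * q v" using Q_ge \<gamma> by (simp add: l_eq)
  have qa: "q v \<le> a v" using Q_le r0[of v] by linarith
  have "q v \<le> z"
  proof (rule ccontr)
    assume "\<not> q v \<le> z"
    then have "z * q v < q v * q v" using z by (intro mult_strict_right_mono) auto
    also have "\<dots> \<le> a v * a v" using qa psd[of v] a0[of v] by (intro mult_mono) auto
    finally show False using Q_ge' by (simp add: power2_eq_square)
  qed
  \<comment> \<open>Eliminating \<open>r v\<close> and \<open>q v\<close> leaves 4 a - 3 a^2 / z,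
    which is largest at a = 2 z / 3 with value 4 z / 3.\<close>
  moreover have "a v + r v \<le> 4/3 * z"
  proof -
    have "z * (a v + r v) \<le> z * (4 * a v - 3 * q v)" using Q_le z by (intro mult_left_mono) auto
    also have "\<dots> \<le> 4 * z * a v - 3 * (a v)\<^sup>2" using Q_ge' by (simp add: algebra_simps)
    also have "\<dots> = 4/3 * z\<^sup>2 - 3 * (a v - 2/3 * z)\<^sup>2" by (simp add: power2_eq_square algebra_simps)
    also have "\<dots> \<le> z * (4/3 * z)" by (simp add: power2_eq_square)
    finally show ?thesis using z by simp
  qed
  moreover have "a v + r v = (\<Sum>j\<in>UNIV. \<bar>v$j\<bar>)"
    unfolding a_def r_def by (subst sum.subset_diff[of S UNIV]) auto
  ultimately show ?thesis
    using that[of v] gS gSc by (simp add: g_def z_def l_def)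
qed

text \<open>Pays for the union bound over the \<open>2 ^ l\<close> certificates: for small \<open>l\<close> by the second lower
  bound on \<open>n\<close>, for large \<open>l\<close> by the first one, as \<open>l \<le> \<xi>\<close>.\<close>
lemma certificate_union_exponent:
  fixes l m :: nat and \<xi> \<delta> n :: real
  assumes l: "1 \<le> l" "l \<le> m" and \<delta>: "0 < \<delta>" "\<delta> < 1" and \<xi>: "real l \<le> \<xi>"
    and n: "n \<ge> 8 * \<xi>\<^sup>2 * ln (8 * (real m)\<^sup>2 / \<delta>)" "n \<ge> 128 * \<xi> * ln (8 * real m / \<delta>)"
  shows "ln (8 * real m / \<delta>) + real l * ln 2 \<le> 236/10000 * (n / \<xi>)"
proof -
  define lm where "lm = ln (real m)"
  define ld where "ld = ln (1 / \<delta>)"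
  define l2 where "l2 = ln (2::real)"
  have pos: "real m > 0" "\<xi> > 0" using l \<xi> by auto
  have ld: "ld \<ge> 0" and l2: "l2 > 0" using \<delta> by (auto simp: ld_def l2_def)
  have l8: "ln (8::real) = 3 * l2" using ln_realpow[of "2::real" 3] by (simp add: l2_def)
  have e1: "ln (8 * real m / \<delta>) = 3 * l2 + lm + ld"
    using pos \<delta> by (simp add: ln_div ln_mult l8 lm_def ld_def)
  have e2: "ln (8 * (real m)\<^sup>2 / \<delta>) = 3 * l2 + 2 * lm + ld"
    using pos \<delta> by (simp add: ln_div ln_mult l8 lm_def ld_def ln_realpow)
  have lm_ge: "lm \<ge> real k * l2" if "2 ^ k \<le> m" for k
  proof -
    have "real k * l2 = ln (2 ^ k)" by (simp add: l2_def ln_realpow)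
    also have "(2 ^ k :: real) \<le> real m" using that by (metis of_nat_le_iff of_nat_numeral of_nat_power)
    then have "ln (2 ^ k) \<le> ln (real m)" using pos by simp
    finally show ?thesis by (simp add: lm_def)
  qed
  define \<nu> where "\<nu> = n / \<xi>"
  have n1: "\<nu> \<ge> 8 * \<xi> * (3 * l2 + 2 * lm + ld)"
    using n(1)[unfolded e2] pos by (simp add: \<nu>_def field_simps power2_eq_square)
  have n2: "\<nu> \<ge> 128 * (3 * l2 + lm + ld)"
    using n(2)[unfolded e1] pos by (simp add: \<nu>_def field_simps)
  define A where "A = real l * l2"
  \<comment> \<open>For l \<le> 12 the bound with 128 is used: 128 * 0.0236 > 3.02, so
    \<open>A\<close> has to fit into 2.02 (3 l2 + lm + ld), with lm bounded below through m \<ge> l.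
    The tightest point is l = 12, where 2.02 * 6 l2 has to cover 12 l2.\<close>
  consider "l \<le> 3" | "4 \<le> l" "l \<le> 7" | "8 \<le> l" "l \<le> 12" | "13 \<le> l" by linarith
  then have "3 * l2 + lm + ld + A \<le> 236/10000 * \<nu>"
  proof cases
    case 1
    have "A \<le> 3 * l2" unfolding A_def using 1 l2 by (intro mult_right_mono) auto
    moreover have "0 \<le> lm" using lm_ge[of 0] l by simp
    ultimately show ?thesis using n2 ld l2 by simp
  next
    case 2
    have "A \<le> 7 * l2" unfolding A_def using 2 l2 by (intro mult_right_mono) auto
    moreover have "2 * l2 \<le> lm" using lm_ge[of 2] l 2 by simp
    ultimately show ?thesis using n2 ld l2 by simp
  next
    case 3
    have "A \<le> 12 * l2" unfolding A_def using 3 l2 by (intro mult_right_mono) auto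
    moreover have "3 * l2 \<le> lm" using lm_ge[of 3] l 3 by simp
    ultimately show ?thesis using n2 ld l2 by simp
  next
    case 4
    \<comment> \<open>Since lm \<ge> 3 l2, A \<le> l s / 9. What remains is l (8 * 0.0236 - 1/9)
      \<ge> 1, which holds from l = 13 on.\<close>
    define s where "s = 3 * l2 + 2 * lm + ld"
    have s: "s \<ge> 9 * l2" "s \<ge> 3 * l2 + lm + ld" using lm_ge[of 3] 4 l ld l2 by (auto simp: s_def)
    have "8 * \<xi> * s \<ge> 8 * real l * s" using s l2 \<xi> by (intro mult_right_mono) auto
    then have "\<nu> \<ge> 8 * real l * s" using n1 by (simp add: s_def)
    moreover have "8 * real l * s * (236/10000) \<ge> s + A"
    proof -
      have "A \<le> real l * (s / 9)" unfolding A_def using s by (intro mult_left_mono) auto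
      moreover have "(8 * real l * (236/10000) - real l / 9 - 1) * s \<ge> 0"
        using 4 s l2 by (intro mult_nonneg_nonneg) auto
      ultimately show ?thesis by (simp add: algebra_simps)
    qed
    ultimately show ?thesis using s by linarith
  qed
  then show ?thesis by (simp add: A_def e1 l2_def \<nu>_def)
qed

section \<open>The LASSO error on a good event\<close>

lemma emp_mean_diff_const:
  "n > 0 \<Longrightarrow> emp_mean n X (\<lambda>x. g x - c) = emp_mean n X g - c"
  by (simp add: emp_mean_def sum_subtractf diff_divide_distrib)

lemma emp_mean_cmult: "emp_mean n X (\<lambda>x. c * g x) = c * emp_mean n X g"
  by (simp add: emp_mean_def sum_distrib_left)

lemma emp_mean_sum: "emp_mean n X (\<lambda>x. \<Sum>j\<in>A. g j x) = (\<Sum>j\<in>A. emp_mean n X (g j))"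
  unfolding emp_mean_def by (subst sum.swap) (simp add: sum_divide_distrib)

lemma emp_mean_add: "emp_mean n X (\<lambda>x. g x + k x) = emp_mean n X g + emp_mean n X k"
  by (simp add: emp_mean_def sum.distrib add_divide_distrib)

lemma emp_mean_diff: "emp_mean n X (\<lambda>x. g x - k x) = emp_mean n X g - emp_mean n X k"
  by (simp add: emp_mean_def sum_subtractf diff_divide_distrib)

lemma emp_mean_mono: "(\<And>i. i < n \<Longrightarrow> g (X i) \<le> k (X i)) \<Longrightarrow> emp_mean n X g \<le> emp_mean n X k"
  by (auto simp: emp_mean_def intro!: divide_right_mono sum_mono)

definition lin_comb :: "('m::finite \<Rightarrow> 'a \<Rightarrow> real) \<Rightarrow> real^'m \<Rightarrow> 'a \<Rightarrow> real" where
  "lin_comb h w x = (\<Sum>j\<in>UNIV. w$j * h j x)"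

lemma emp_mean_lin_comb:
  "emp_mean n X (lin_comb h v) = (\<Sum>j\<in>UNIV. v$j * emp_mean n X (h j))"
  by (simp add: lin_comb_def[abs_def] emp_mean_sum emp_mean_cmult)

text \<open>Apart from the penalty, the left side is linear in the coefficient error for every test
  vector \<open>w\<close>, which may depend on the sample. Centering survives only as the product of
  two empirical means, a second-order term.\<close>

lemma lasso_basic_inequality:
  fixes h :: "'m::finite \<Rightarrow> 'a \<Rightarrow> real" and \<beta> \<beta>s w :: "real^'m"
  assumes n: "n > 0" and lasso: "is_lasso_beta n X f h lam \<beta>"
    and f: "\<And>x. f x = \<mu> + lin_comb h \<beta>s x + \<epsilon> x"
  defines "u \<equiv> \<beta> - \<beta>s"
  shows "emp_mean n X (\<lambda>x. lin_comb h u x * (lin_comb h w x - \<epsilon> x))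
           - emp_mean n X (lin_comb h u) * emp_mean n X (\<lambda>x. lin_comb h w x - \<epsilon> x)
           + lam * ((\<Sum>j\<in>UNIV. \<bar>\<beta>$j\<bar>) - (\<Sum>j\<in>UNIV. \<bar>\<beta>s$j\<bar>))
         \<le> emp_mean n X (\<lambda>x. (lin_comb h w x)\<^sup>2) / 2"
proof -
  define c where "c = (\<lambda>g i. g (X i) - emp_mean n X g)"
  have sum_c: "(\<Sum>i<n. c g i) = 0" for g
    using n by (simp add: c_def emp_mean_def sum_subtractf)
  have c_lin: "c (lin_comb h v) i = (\<Sum>j\<in>UNIV. c (h j) i * v$j)" for v i
    unfolding c_def emp_mean_lin_comb lin_comb_def
    by (simp add: sum_subtractf algebra_simps)
  have cf: "c f i = c (lin_comb h \<beta>s) i + c \<epsilon> i" for i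
  proof -
    have "f = (\<lambda>x. \<mu> + lin_comb h \<beta>s x + \<epsilon> x)" using f by auto
    then have "emp_mean n X f = \<mu> + emp_mean n X (lin_comb h \<beta>s) + emp_mean n X \<epsilon>"
      using n by (simp add: emp_mean_add) (simp add: emp_mean_def)
    then show ?thesis by (simp add: c_def f)
  qed
  have c_sub: "c (lin_comb h (v - v')) i = c (lin_comb h v) i - c (lin_comb h v') i" for v v' i
    by (simp add: c_lin algebra_simps sum_subtractf)
  define a where "a = c (lin_comb h u)"
  define b where "b = c (lin_comb h w)"
  define e where "e = c \<epsilon>"
  have obj: "lasso_obj n X f h lam v
      = (\<Sum>i<n. (c f i - c (lin_comb h v) i)\<^sup>2) / (2 * real n) + lam * (\<Sum>j\<in>UNIV. \<bar>v$j\<bar>)" for v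
    unfolding c_lin by (simp add: lasso_obj_def c_def)
  have "lasso_obj n X f h lam \<beta> \<le> lasso_obj n X f h lam \<beta>s"
    using lasso by (simp add: is_lasso_beta_def)
  then have "(\<Sum>i<n. (e i - a i)\<^sup>2) / (2 * real n) + lam * (\<Sum>j\<in>UNIV. \<bar>\<beta>$j\<bar>)
      \<le> (\<Sum>i<n. (e i)\<^sup>2) / (2 * real n) + lam * (\<Sum>j\<in>UNIV. \<bar>\<beta>s$j\<bar>)"
    unfolding obj by (simp add: cf e_def a_def u_def c_sub algebra_simps)
  moreover have "(\<Sum>i<n. (e i)\<^sup>2) + 2 * (\<Sum>i<n. a i * (b i - e i)) - (\<Sum>i<n. (b i)\<^sup>2) \<le> (\<Sum>i<n. (e i - a i)\<^sup>2)"
  proof -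
    have "(\<Sum>i<n. (e i)\<^sup>2) + 2 * (\<Sum>i<n. a i * (b i - e i)) - (\<Sum>i<n. (b i)\<^sup>2)
        = (\<Sum>i<n. (e i)\<^sup>2 + 2 * (a i * (b i - e i)) - (b i)\<^sup>2)"
      by (simp add: sum.distrib sum_subtractf sum_distrib_left)
    also have "\<dots> \<le> (\<Sum>i<n. (e i - a i)\<^sup>2)"
    proof (rule sum_mono)
      fix i
      have "0 \<le> (a i - b i)\<^sup>2" by simp
      then show "(e i)\<^sup>2 + 2 * (a i * (b i - e i)) - (b i)\<^sup>2 \<le> (e i - a i)\<^sup>2"
        by (simp add: power2_eq_square algebra_simps)
    qed
    finally show ?thesis .
  qed
  ultimately have "2 * (\<Sum>i<n. a i * (b i - e i)) / (2 * real n) - (\<Sum>i<n. (b i)\<^sup>2) / (2 * real n)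
       + lam * (\<Sum>j\<in>UNIV. \<bar>\<beta>$j\<bar>) \<le> lam * (\<Sum>j\<in>UNIV. \<bar>\<beta>s$j\<bar>)"
    using n divide_right_mono[of "(\<Sum>i<n. (e i)\<^sup>2) + 2 * (\<Sum>i<n. a i * (b i - e i)) - (\<Sum>i<n. (b i)\<^sup>2)" _ "2 * real n"]
    by (fastforce simp: add_divide_distrib diff_divide_distrib)
  then have main: "(\<Sum>i<n. a i * (b i - e i)) / real n + lam * ((\<Sum>j\<in>UNIV. \<bar>\<beta>$j\<bar>) - (\<Sum>j\<in>UNIV. \<bar>\<beta>s$j\<bar>))
       \<le> (\<Sum>i<n. (b i)\<^sup>2) / real n / 2"
    by (simp add: algebra_simps)
  have cov: "(\<Sum>i<n. c g i * c k i) / real n = emp_mean n X (\<lambda>x. g x * k x) - emp_mean n X g * emp_mean n X k" for g k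
  proof -
    have "(\<Sum>i<n. c g i * c k i) = (\<Sum>i<n. g (X i) * k (X i)) - emp_mean n X k * (\<Sum>i<n. g (X i))
        - emp_mean n X g * (\<Sum>i<n. c k i)"
      by (simp add: c_def algebra_simps sum_subtractf sum.distrib sum_distrib_left)
    then show ?thesis unfolding sum_c by (simp add: emp_mean_def diff_divide_distrib)
  qed
  have "b i - e i = c (\<lambda>x. lin_comb h w x - \<epsilon> x) i" for i
    by (simp add: b_def e_def c_def emp_mean_diff)
  then have 1: "(\<Sum>i<n. a i * (b i - e i)) / real n = emp_mean n X (\<lambda>x. lin_comb h u x * (lin_comb h w x - \<epsilon> x))
           - emp_mean n X (lin_comb h u) * emp_mean n X (\<lambda>x. lin_comb h w x - \<epsilon> x)"
    by (simp add: cov a_def)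
  \<comment> \<open>Centering can only decrease an empirical second moment; the squared mean is
    dropped.\<close>
  have "(\<Sum>i<n. (b i)\<^sup>2) / real n \<le> emp_mean n X (\<lambda>x. (lin_comb h w x)\<^sup>2)"
    using cov[of "lin_comb h w" "lin_comb h w"] by (simp add: b_def power2_eq_square)
  then show ?thesis by (intro order_trans[OF main[unfolded 1] divide_right_mono]) auto
qed

text \<open>The deviations consume the margin \<open>1/2\<close> down to
  \<open>1/2 - 59/200 - 23/200 - 1/32 - 13/500 = 131/4000\<close>.\<close>
lemma lasso_l1_error_bound:
  fixes h :: "'m::finite \<Rightarrow> 'a \<Rightarrow> real" and \<beta> \<beta>s v0 v1 :: "real^'m"
  assumes n: "n > 0" and lasso: "is_lasso_beta n X f h lam \<beta>"
    and f: "\<And>x. f x = \<mu> + lin_comb h \<beta>s x + \<epsilon> x"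
    and lam: "lam > 0"
    and v0: "(\<Sum>j\<in>UNIV. \<bar>v0$j\<bar>) \<le> 4/3 * z" and v1: "(\<Sum>j\<in>UNIV. \<bar>v1$j\<bar>) \<le> 4/3 * z"
    and g0: "\<And>j. \<beta>s$j \<noteq> 0 \<Longrightarrow> g0 j = - sgn (\<beta>s$j)" "\<And>j. \<beta>s$j = 0 \<Longrightarrow> \<bar>g0 j\<bar> \<le> 1/3"
    and g1: "\<And>j. \<beta>s$j \<noteq> 0 \<Longrightarrow> g1 j = (if \<beta>$j - \<beta>s$j \<ge> 0 then 1 else -1)"
            "\<And>j. \<beta>s$j = 0 \<Longrightarrow> \<bar>g1 j\<bar> \<le> 1/3"
    and dev0: "\<And>j. \<bar>emp_mean n X (\<lambda>x. h j x * (lin_comb h v0 x - \<epsilon> x / lam)) - g0 j\<bar> \<le> 59/200"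
    and dev1: "\<And>j. \<bar>emp_mean n X (\<lambda>x. h j x * lin_comb h v1 x) - g1 j\<bar> \<le> 23/100"
    and sq0: "emp_mean n X (\<lambda>x. (lin_comb h v0 x)\<^sup>2) \<le> 98/75 * z"
    and sq1: "emp_mean n X (\<lambda>x. (lin_comb h v1 x)\<^sup>2) \<le> 98/75 * z"
    and c: "\<And>j. \<bar>emp_mean n X (h j)\<bar> \<le> c"
    and zc: "2 * z * c\<^sup>2 \<le> 1/32" and ce: "c * \<bar>emp_mean n X \<epsilon>\<bar> \<le> 13/500 * lam"
  shows "(\<Sum>j\<in>UNIV. \<bar>\<beta>$j - \<beta>s$j\<bar>) \<le> 48 * lam * z"
proof -
  define u where "u = \<beta> - \<beta>s"
  define w where "w = lam *\<^sub>R (v0 + (1/2) *\<^sub>R v1)"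
  define N where "N = (\<Sum>j\<in>UNIV. \<bar>u$j\<bar>)"
  have N0: "N \<ge> 0" by (auto simp: N_def intro: sum_nonneg)
  have c0: "c \<ge> 0" using c abs_ge_zero order_trans by blast
  define D0 where "D0 = (\<lambda>j. emp_mean n X (\<lambda>x. h j x * (lin_comb h v0 x - \<epsilon> x / lam)))"
  define D1 where "D1 = (\<lambda>j. emp_mean n X (\<lambda>x. h j x * lin_comb h v1 x))"
  define pen where "pen = (\<lambda>j. \<bar>\<beta>$j\<bar> - \<bar>\<beta>s$j\<bar>)"
  have lin_w: "lin_comb h w x = lam * (lin_comb h v0 x + lin_comb h v1 x / 2)" for x
    by (simp add: w_def lin_comb_def sum_distrib_left sum.distrib algebra_simps sum_divide_distrib)
  have abs_mean_le: "\<bar>emp_mean n X (lin_comb h v)\<bar> \<le> (\<Sum>j\<in>UNIV. \<bar>v$j\<bar>) * c" for v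
  proof -
    have "\<bar>emp_mean n X (lin_comb h v)\<bar> \<le> (\<Sum>j\<in>UNIV. \<bar>v$j * emp_mean n X (h j)\<bar>)"
      unfolding emp_mean_lin_comb by (rule sum_abs)
    also have "\<dots> \<le> (\<Sum>j\<in>UNIV. \<bar>v$j\<bar> * c)"
      unfolding abs_mult by (intro sum_mono mult_left_mono c) auto
    finally show ?thesis by (simp add: sum_distrib_right)
  qed
  have A: "emp_mean n X (\<lambda>x. lin_comb h u x * (lin_comb h w x - \<epsilon> x))
      = lam * (\<Sum>j\<in>UNIV. u$j * (D0 j + D1 j / 2))"
  proof -
    have "(\<lambda>x. lin_comb h u x * (lin_comb h w x - \<epsilon> x)) = (\<lambda>x. \<Sum>j\<in>UNIV. lam * u$j *
        (h j x * (lin_comb h v0 x - \<epsilon> x / lam) + 1/2 * (h j x * lin_comb h v1 x)))"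
    proof
      fix x
      define e where "e = \<epsilon> x / lam"
      have eq: "lin_comb h w x - \<epsilon> x = lam * (lin_comb h v0 x - \<epsilon> x / lam + lin_comb h v1 x / 2)"
        using lam by (simp add: lin_w field_simps)
      show "lin_comb h u x * (lin_comb h w x - \<epsilon> x) = (\<Sum>j\<in>UNIV. lam * u$j *
        (h j x * (lin_comb h v0 x - \<epsilon> x / lam) + 1/2 * (h j x * lin_comb h v1 x)))"
        unfolding eq lin_comb_def[of h u] sum_distrib_right e_def[symmetric]
        by (intro sum.cong refl) (simp add: algebra_simps)
    qed
    then show ?thesis
      by (simp only: emp_mean_sum emp_mean_cmult emp_mean_add D0_def D1_def)
         (simp add: sum_distrib_left algebra_simps)
  qed
  \<comment> \<open>Both means are small. The l1 norm of \<open>w\<close> is at most lam (4/3 + 2/3)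
    z = 2 lam z, which is the factor 2 in \<open>zc\<close>.\<close>
  have B: "\<bar>emp_mean n X (lin_comb h u) * emp_mean n X (\<lambda>x. lin_comb h w x - \<epsilon> x)\<bar>
      \<le> lam * N * (1/32 + 13/500)"
  proof -
    have "(\<Sum>j\<in>UNIV. \<bar>w$j\<bar>) \<le> lam * (\<Sum>j\<in>UNIV. \<bar>v0$j\<bar> + \<bar>v1$j\<bar> / 2)"
      unfolding w_def sum_distrib_left using lam
      by (intro sum_mono) (auto simp: abs_mult intro!: mult_left_mono order_trans[OF abs_triangle_ineq])
    also have "\<dots> \<le> lam * (2 * z)"
      using v0 v1 lam by (intro mult_left_mono) (auto simp: sum.distrib sum_divide_distrib[symmetric])
    finally have "(\<Sum>j\<in>UNIV. \<bar>w$j\<bar>) * c \<le> lam * (2 * z) * c" using c0 by (rule mult_right_mono)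
    then have "\<bar>emp_mean n X (\<lambda>x. lin_comb h w x - \<epsilon> x)\<bar> \<le> lam * (2 * z) * c + \<bar>emp_mean n X \<epsilon>\<bar>"
      using abs_mean_le[of w] by (simp add: emp_mean_diff)
    then have "\<bar>emp_mean n X (lin_comb h u)\<bar> * \<bar>emp_mean n X (\<lambda>x. lin_comb h w x - \<epsilon> x)\<bar>
        \<le> (N * c) * (lam * (2 * z) * c + \<bar>emp_mean n X \<epsilon>\<bar>)"
      using abs_mean_le[of u] N0 c0 unfolding N_def by (intro mult_mono) auto
    also have "\<dots> = N * (lam * (2 * z * c\<^sup>2) + c * \<bar>emp_mean n X \<epsilon>\<bar>)"
      by (simp add: power2_eq_square algebra_simps)
    also have "\<dots> \<le> N * (lam * (1/32) + 13/500 * lam)"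
      using zc ce lam N0 by (intro mult_left_mono add_mono) auto
    finally show ?thesis by (simp add: abs_mult algebra_simps)
  qed
  \<comment> \<open>The population functionals leave slack 1/2 in every coordinate, on and off the
    support alike; the deviations cost 59/200 + (23/100) / 2 = 41/100 of it.\<close>
  have coord: "u$j * (D0 j + D1 j / 2) + pen j \<ge> (1/2 - 41/100) * \<bar>u$j\<bar>" for j
  proof -
    have "u$j * (g0 j + g1 j / 2) + pen j \<ge> 1/2 * \<bar>u$j\<bar>"
    proof (cases "\<beta>s$j = 0")
      case True
      have "\<bar>u$j * (g0 j + g1 j / 2)\<bar> \<le> \<bar>u$j\<bar> * (1/2)"
        unfolding abs_mult using g0(2)[OF True] g1(2)[OF True] abs_triangle_ineq[of "g0 j" "g1 j / 2"]
        by (intro mult_left_mono) auto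
      then show ?thesis using True by (simp add: pen_def u_def)
    next
      case False
      have "u$j * g1 j = \<bar>u$j\<bar>" using g1(1)[OF False] by (auto simp: u_def)
      moreover have "pen j \<ge> sgn (\<beta>s$j) * u$j"
        using False by (auto simp: pen_def u_def sgn_if)
      moreover have "u$j * g0 j = - (sgn (\<beta>s$j) * u$j)" using g0(1)[OF False] by simp
      ultimately show ?thesis by (simp add: algebra_simps)
    qed
    moreover have "\<bar>u$j * ((D0 j + D1 j / 2) - (g0 j + g1 j / 2))\<bar> \<le> \<bar>u$j\<bar> * (41/100)"
    proof -
      have "\<bar>D0 j - g0 j\<bar> \<le> 59/200" "\<bar>D1 j - g1 j\<bar> \<le> 23/100"
        using dev0[of j] dev1[of j] by (simp_all add: D0_def D1_def)
      then have "\<bar>(D0 j + D1 j / 2) - (g0 j + g1 j / 2)\<bar> \<le> 41/100"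
        unfolding abs_le_iff by auto
      then show ?thesis unfolding abs_mult by (intro mult_left_mono) auto
    qed
    note abs_le_D2[OF this]
    ultimately show ?thesis by (simp add: algebra_simps)
  qed
  have "(1/2 - 41/100) * N \<le> (\<Sum>j\<in>UNIV. u$j * (D0 j + D1 j / 2) + pen j)"
    unfolding N_def sum_distrib_left by (intro sum_mono coord)
  then have low: "(1/2 - 41/100) * N \<le> (\<Sum>j\<in>UNIV. u$j * (D0 j + D1 j / 2)) + (\<Sum>j\<in>UNIV. pen j)"
    by (simp add: sum.distrib)
  have "emp_mean n X (\<lambda>x. (lin_comb h w x)\<^sup>2)
      \<le> emp_mean n X (\<lambda>x. lam\<^sup>2 * (3/2 * (lin_comb h v0 x)\<^sup>2 + 3/4 * (lin_comb h v1 x)\<^sup>2))"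
  proof (rule emp_mean_mono)
    fix i
    \<comment> \<open>Young's inequality with equality at a = b: the weights sum to (1 + 1/2)^2, so
      nothing is lost when both second moments have the same bound.\<close>
    have "(a + b / 2)\<^sup>2 \<le> 3/2 * a\<^sup>2 + 3/4 * b\<^sup>2" for a b :: real
    proof -
      have "0 \<le> (a - b)\<^sup>2 / 2" by simp
      then show ?thesis by (simp add: power2_eq_square field_simps)
    qed
    then show "(lin_comb h w (X i))\<^sup>2 \<le> lam\<^sup>2 * (3/2 * (lin_comb h v0 (X i))\<^sup>2 + 3/4 * (lin_comb h v1 (X i))\<^sup>2)"
      unfolding lin_w power_mult_distrib by (intro mult_left_mono) auto
  qed
  also have "\<dots> \<le> lam\<^sup>2 * (3/2 * (98/75 * z) + 3/4 * (98/75 * z))"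
    unfolding emp_mean_cmult emp_mean_add using sq0 sq1 by (intro mult_left_mono add_mono) auto
  finally have "emp_mean n X (\<lambda>x. (lin_comb h w x)\<^sup>2) / 2 \<le> lam * (147/100 * lam * z)"
    by (simp add: power2_eq_square)
  moreover have "lam * (\<Sum>j\<in>UNIV. u$j * (D0 j + D1 j / 2))
           - emp_mean n X (lin_comb h u) * emp_mean n X (\<lambda>x. lin_comb h w x - \<epsilon> x)
           + lam * (\<Sum>j\<in>UNIV. pen j)
         \<le> emp_mean n X (\<lambda>x. (lin_comb h w x)\<^sup>2) / 2"
    using lasso_basic_inequality[OF n lasso f, of w]
    by (simp add: A[unfolded u_def] u_def pen_def sum_subtractf)
  moreover have "lam * ((1/2 - 41/100) * N) \<le> lam * (\<Sum>j\<in>UNIV. u$j * (D0 j + D1 j / 2)) + lam * (\<Sum>j\<in>UNIV. pen j)"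
    using mult_left_mono[OF low, of lam] lam by (simp add: distrib_left)
  ultimately have "lam * ((1/2 - 41/100) * N) - lam * N * (1/32 + 13/500) \<le> lam * (147/100 * lam * z)"
    using B by linarith
  then have "lam * (131/4000 * N) \<le> lam * (147/100 * lam * z)" by (simp add: algebra_simps)
  then have "131/4000 * N \<le> 147/100 * lam * z" using lam by simp
  \<comment> \<open>The quotient of the constants is below 44.9; the sign of \<open>lam * z\<close>,
    inferred from the bound itself, permits rounding up to 48.\<close>
  moreover have "lam * z \<ge> 0" using calculation N0 by simp
  ultimately show ?thesis by (simp add: N_def u_def)
qed

section \<open>Probability of the good event\<close>

lemma (in prob_space) prob_Int_ge:
  assumes "A \<in> events" "B \<in> events"
  shows "prob (A \<inter> B) \<ge> prob A + prob B - 1"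
proof -
  have "prob (A - B) = prob A - prob (A \<inter> B)" using assms by (rule finite_measure_Diff')
  moreover have "prob (A - B) \<le> prob (space M - B)"
    using assms sets.sets_into_space[OF assms(1)] by (intro finite_measure_mono) auto
  ultimately show ?thesis using prob_compl[OF assms(2)] by linarith
qed

locale bounded_control_variates = prob_space M
  for M :: "'a measure" +
  fixes h :: "'m::finite \<Rightarrow> 'a \<Rightarrow> real" and U :: real
  assumes h_meas [measurable]: "\<And>j. h j \<in> borel_measurable M"
    and h_le: "\<And>j x. x \<in> space M \<Longrightarrow> \<bar>h j x\<bar> \<le> U"
begin

lemma U_nonneg: "U \<ge> 0"
  using not_empty h_le abs_ge_zero order_trans by blast

lemma lin_comb_measurable [measurable]: "lin_comb h v \<in> borel_measurable M"
  unfolding lin_comb_def[abs_def] by measurable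

lemma abs_lin_comb_le:
  assumes "x \<in> space M"
  shows "\<bar>lin_comb h v x\<bar> \<le> U * (\<Sum>j\<in>UNIV. \<bar>v$j\<bar>)"
proof -
  have "\<bar>lin_comb h v x\<bar> \<le> (\<Sum>j\<in>UNIV. \<bar>v$j * h j x\<bar>)"
    unfolding lin_comb_def by (rule sum_abs)
  also have "\<dots> \<le> (\<Sum>j\<in>UNIV. \<bar>v$j\<bar> * U)"
    unfolding abs_mult using h_le[OF assms] by (intro sum_mono mult_left_mono) auto
  finally show ?thesis by (simp add: sum_distrib_left mult.commute)
qed

lemma integrable_bounded_mult:
  fixes g k :: "'a \<Rightarrow> real"
  assumes g: "integrable M g" and [measurable]: "k \<in> borel_measurable M"
    and k: "\<And>x. x \<in> space M \<Longrightarrow> \<bar>k x\<bar> \<le> B"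
  shows "integrable M (\<lambda>x. k x * g x)"
proof (rule Bochner_Integration.integrable_bound[of M "\<lambda>x. B * g x"])
  show "AE x in M. norm (k x * g x) \<le> norm (B * g x)"
    by (intro AE_I2) (auto simp: abs_mult intro!: mult_right_mono order_trans[OF k])
qed (use g in auto)

lemma integrable_h: "integrable M (h j)"
  by (rule integrable_const_bound[where B = U]) (auto intro!: AE_I2 h_le)

lemma integrable_hh: "integrable M (\<lambda>x. h j x * h k x)"
  by (rule integrable_bounded_mult[OF integrable_h]) (auto intro: h_le)

lemma integral_h_lin_comb:
  "integrable M (\<lambda>x. h j x * lin_comb h v x)"
  "(\<integral>x. h j x * lin_comb h v x \<partial>M) = (\<Sum>k\<in>UNIV. gram M h j k * v$k)"
proof -
  have eq: "(\<lambda>x. h j x * lin_comb h v x) = (\<lambda>x. \<Sum>k\<in>UNIV. v$k * (h j x * h k x))"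
    by (auto simp: lin_comb_def sum_distrib_left algebra_simps)
  show "integrable M (\<lambda>x. h j x * lin_comb h v x)"
    unfolding eq using integrable_hh by auto
  show "(\<integral>x. h j x * lin_comb h v x \<partial>M) = (\<Sum>k\<in>UNIV. gram M h j k * v$k)"
    unfolding eq using integrable_hh by (simp add: gram_def mult.commute)
qed

lemma integral_lin_comb_sq:
  "(\<integral>x. (lin_comb h v x)\<^sup>2 \<partial>M) = (\<Sum>j\<in>UNIV. v$j * (\<Sum>k\<in>UNIV. gram M h j k * v$k))"
proof -
  have eq: "(\<lambda>x. (lin_comb h v x)\<^sup>2) = (\<lambda>x. \<Sum>j\<in>UNIV. v$j * (h j x * lin_comb h v x))"
    by (subst lin_comb_def[abs_def]) (auto simp: power2_eq_square lin_comb_def sum_distrib_right sum_distrib_left algebra_simps)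
  show ?thesis
    unfolding eq using integral_h_lin_comb by simp
qed

text \<open>Along coordinate j the risk is a quadratic polynomial in the step length, with linear
  coefficient -2 E(h_j \<epsilon>); minimality at step 0 forces it to vanish.\<close>

lemma pop_risk_minimizer_orthogonal:
  assumes \<epsilon>_def: "\<And>x. \<epsilon> x = f x - (\<integral>y. f y \<partial>M) - lin_comb h \<beta>s x"
    and [measurable]: "\<epsilon> \<in> borel_measurable M" and \<epsilon>2: "integrable M (\<lambda>x. (\<epsilon> x)\<^sup>2)"
    and min: "\<And>\<beta>. pop_risk M f h \<beta>s \<le> pop_risk M f h \<beta>"
  shows "(\<integral>x. h j x * \<epsilon> x \<partial>M) = 0"
proof -
  have \<epsilon>1: "integrable M \<epsilon>" by (rule square_integrable_imp_integrable[OF _ \<epsilon>2]) simp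
  have h\<epsilon>: "integrable M (\<lambda>x. h j x * \<epsilon> x)" by (rule integrable_bounded_mult[OF \<epsilon>1]) (auto intro: h_le)
  have "0 \<le> (- 2 * (\<integral>x. h j x * \<epsilon> x \<partial>M)) * e + (\<integral>x. h j x * h j x \<partial>M) * e\<^sup>2 + 0 * \<bar>e\<bar>" for e
  proof -
    have lin: "lin_comb h (\<beta>s + e *\<^sub>R axis j 1) x = lin_comb h \<beta>s x + e * h j x" for x
      by (simp add: lin_comb_def sum.distrib distrib_right axis_def if_distrib[of "\<lambda>x. x * _"]
           if_distrib[of "\<lambda>x. _ * x"] cong: if_cong)
    have risk: "pop_risk M f h \<beta> = (\<integral>x. (f x - (\<integral>y. f y \<partial>M) - lin_comb h \<beta> x)\<^sup>2 \<partial>M)" for \<beta>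
      by (simp add: pop_risk_def lin_comb_def)
    have "pop_risk M f h (\<beta>s + e *\<^sub>R axis j 1)
        = (\<integral>x. (\<epsilon> x)\<^sup>2 - 2 * e * (h j x * \<epsilon> x) + e\<^sup>2 * (h j x * h j x) \<partial>M)"
      unfolding risk lin by (intro Bochner_Integration.integral_cong refl) (simp add: \<epsilon>_def power2_eq_square algebra_simps)
    also have "\<dots> = (\<integral>x. (\<epsilon> x)\<^sup>2 \<partial>M) - 2 * e * (\<integral>x. h j x * \<epsilon> x \<partial>M) + e\<^sup>2 * (\<integral>x. h j x * h j x \<partial>M)"
      using \<epsilon>2 h\<epsilon> integrable_hh[of j j] by simp
    moreover have "pop_risk M f h \<beta>s = (\<integral>x. (\<epsilon> x)\<^sup>2 \<partial>M)" by (simp add: risk \<epsilon>_def)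
    ultimately show ?thesis using min[of "\<beta>s + e *\<^sub>R axis j 1"] by (simp add: algebra_simps)
  qed
  then have "\<bar>- 2 * (\<integral>x. h j x * \<epsilon> x \<partial>M)\<bar> \<le> 0" by (rule abs_coeff_le_if_nonneg_near_0)
  then show ?thesis by simp
qed

lemma mean_event:
  assumes mean0: "\<And>j. (\<integral>x. h j x \<partial>M) = 0" and U: "U > 0" and n: "n > 0" and L: "L > 0"
  shows "\<exists>E \<in> sets (PiM {..<n} (\<lambda>_. M)).
           measure (PiM {..<n} (\<lambda>_. M)) E \<ge> 1 - 2 * real CARD('m) * exp (- L) \<and>
           (\<forall>X\<in>E. \<forall>j. \<bar>emp_mean n X (h j)\<bar> < U * sqrt (2 * L / real n))"
proof -
  define c where "c = U * sqrt (2 * L / real n)"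
  \<comment> \<open>The minimizer of t^2 U^2 / 2 - t c.\<close>
  define t where "t = c / U\<^sup>2"
  have c: "c > 0" using U n L by (simp add: c_def)
  then have t: "t > 0" using U by (simp add: t_def)
  have c2: "c\<^sup>2 = U\<^sup>2 * (2 * L / real n)" using n L by (simp add: c_def power_mult_distrib)
  have e: "real n * (t\<^sup>2 * U\<^sup>2 / 2 - t * c) = - L"
  proof -
    have "t\<^sup>2 * U\<^sup>2 / 2 - t * c = - (c\<^sup>2 / U\<^sup>2) / 2"
      using U by (simp add: t_def power2_eq_square field_simps)
    then show ?thesis using U n by (simp add: c2)
  qed
  have "\<exists>E \<in> sets (PiM {..<n} (\<lambda>_. M)).
           measure (PiM {..<n} (\<lambda>_. M)) E \<ge> 1 - 2 * real CARD('m) * exp (real n * (t\<^sup>2 * U\<^sup>2 / 2 - t * c)) \<and>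
           (\<forall>X\<in>E. \<forall>j\<in>UNIV. \<bar>emp_mean n X (h j)\<bar> < c)"
  proof (rule chernoff_union[OF prob_space_axioms finite n t])
    fix j s assume "s = t \<or> s = - t"
    then show "(\<integral>\<^sup>+ x. ennreal (exp (s * h j x)) \<partial>M) \<le> ennreal (exp (t\<^sup>2 * U\<^sup>2 / 2))"
      using mgf_hoeffding_le[OF h_meas h_le mean0, of s j] t by auto
  qed simp
  then show ?thesis by (simp only: e c_def[symmetric]) simp
qed

end

lemma (in prob_space) noise_event:
  assumes "subgaussian M (\<tau>\<^sup>2) \<epsilon>" and "\<epsilon> \<in> borel_measurable M" and \<tau>: "\<tau> > 0" and n: "n > 0" and L: "L > 0"
  shows "\<exists>E \<in> sets (PiM {..<n} (\<lambda>_. M)).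
           measure (PiM {..<n} (\<lambda>_. M)) E \<ge> 1 - 2 * exp (- L) \<and>
           (\<forall>X\<in>E. \<bar>emp_mean n X \<epsilon>\<bar> < sqrt (2 * L) * \<tau> / sqrt (real n))"
proof -
  define c where "c = sqrt (2 * L) * \<tau> / sqrt (real n)"
  define t where "t = c / \<tau>\<^sup>2"
  have c: "c > 0" using \<tau> n L by (simp add: c_def)
  then have t: "t > 0" using \<tau> by (simp add: t_def)
  have c2: "c\<^sup>2 = \<tau>\<^sup>2 * (2 * L / real n)" using n L by (simp add: c_def power_mult_distrib power_divide)
  have e: "real n * (t\<^sup>2 * \<tau>\<^sup>2 / 2 - t * c) = - L"
  proof -
    have "t\<^sup>2 * \<tau>\<^sup>2 / 2 - t * c = - (c\<^sup>2 / \<tau>\<^sup>2) / 2"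
      using \<tau> by (simp add: t_def power2_eq_square field_simps)
    then show ?thesis using \<tau> n by (simp add: c2)
  qed
  have "\<exists>E \<in> sets (PiM {..<n} (\<lambda>_. M)).
           measure (PiM {..<n} (\<lambda>_. M)) E \<ge> 1 - 2 * real (card {()}) * exp (real n * (t\<^sup>2 * \<tau>\<^sup>2 / 2 - t * c)) \<and>
           (\<forall>X\<in>E. \<forall>j\<in>{()}. \<bar>emp_mean n X \<epsilon>\<bar> < c)"
  proof (rule chernoff_union[OF prob_space_axioms _ n t])
    fix s assume "s = t \<or> s = - t"
    then show "(\<integral>\<^sup>+ x. ennreal (exp (s * \<epsilon> x)) \<partial>M) \<le> ennreal (exp (t\<^sup>2 * \<tau>\<^sup>2 / 2))"
      using assms(1) unfolding subgaussian_def by (metis power2_minus)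
  qed (use assms in auto)
  then show ?thesis by (simp only: e c_def[symmetric]) simp
qed

context bounded_control_variates
begin

text \<open>Each product h_j v^T h has range 4/3 \<xi> and second moment at most U^2 z = \<xi>.
  Using the variance gives an exponent of order n / \<xi>, where the range alone would give n /
  \<xi>^2.\<close>

lemma certificate_event:
  fixes V :: "'i \<Rightarrow> real^'m"
  assumes I: "finite I" and n: "n > 0" and z: "z > 0" and U: "U > 0"
    and V1: "\<And>i. i \<in> I \<Longrightarrow> (\<Sum>j\<in>UNIV. \<bar>V i $ j\<bar>) \<le> 4/3 * z"
    and V2: "\<And>i. i \<in> I \<Longrightarrow> (\<integral>x. (lin_comb h (V i) x)\<^sup>2 \<partial>M) \<le> z"
    and T: "T \<le> 236/10000 * (real n / (z * U\<^sup>2))"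
  shows "\<exists>E \<in> sets (PiM {..<n} (\<lambda>_. M)).
           measure (PiM {..<n} (\<lambda>_. M)) E \<ge> 1 - 2 * (real (card I) * real CARD('m)) * exp (- T) \<and>
           (\<forall>X\<in>E. \<forall>i\<in>I. \<forall>j. \<bar>emp_mean n X (\<lambda>x. h j x * lin_comb h (V i) x)
               - (\<Sum>k\<in>UNIV. gram M h j k * V i $ k)\<bar> < 23/100)"
proof -
  define \<xi> where "\<xi> = z * U\<^sup>2"
  have \<xi>: "\<xi> > 0" using z U by (simp add: \<xi>_def)
  \<comment> \<open>Close to 23 / (112 \<xi>), the minimizer of 14/25 \<xi> t^2 - 23/100 t; at 1 /
    (5 \<xi>) the value is -0.0236 / \<xi>, the source of 236/10000.\<close>
  define t where "t = 1 / (5 * \<xi>)"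
  have t: "t > 0" using \<xi> by (simp add: t_def)
  define m where "m = (\<lambda>i j. \<Sum>k\<in>UNIV. gram M h j k * V i $ k)"
  define K where "K = 14/25 * (t\<^sup>2 * \<xi>)"
  have e: "real n * (K - t * (23/100)) = - (236/10000 * (real n / \<xi>))"
    using \<xi> by (simp add: K_def t_def power2_eq_square field_simps)
  have "\<exists>E \<in> sets (PiM {..<n} (\<lambda>_. M)).
           measure (PiM {..<n} (\<lambda>_. M)) E \<ge> 1 - 2 * real (card (I \<times> (UNIV::'m set))) * exp (real n * (K - t * (23/100))) \<and>
           (\<forall>X\<in>E. \<forall>p\<in>I \<times> UNIV. \<bar>emp_mean n X (\<lambda>x. h (snd p) x * lin_comb h (V (fst p)) x - m (fst p) (snd p))\<bar> < 23/100)"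
  proof (rule chernoff_union[OF prob_space_axioms _ n t])
    fix p s assume p: "p \<in> I \<times> (UNIV::'m set)" and s: "s = t \<or> s = - t"
    obtain i j where ij: "p = (i, j)" "i \<in> I" using p by auto
    define Y where "Y = (\<lambda>x. h j x * lin_comb h (V i) x)"
    have Yle: "\<bar>Y x\<bar> \<le> U * \<bar>lin_comb h (V i) x\<bar>" if "x \<in> space M" for x
      unfolding Y_def abs_mult using h_le[OF that] by (intro mult_right_mono) auto
    have "(\<integral>\<^sup>+x. ennreal (exp (s * (Y x - (\<integral>x. Y x \<partial>M)))) \<partial>M) \<le> ennreal (exp (14/25 * (t\<^sup>2 * \<xi>)))"
    proof (rule mgf_bounded_le)
      fix x assume x: "x \<in> space M"
      have "\<bar>s * Y x\<bar> = t * \<bar>Y x\<bar>" using s t by (auto simp: abs_mult)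
      also have "\<dots> \<le> t * (U * (U * (4/3 * z)))"
      proof (intro mult_left_mono)
        have "\<bar>lin_comb h (V i) x\<bar> \<le> U * (4/3 * z)"
          using U by (intro order_trans[OF abs_lin_comb_le[OF x]] mult_left_mono V1 ij) auto
        then show "\<bar>Y x\<bar> \<le> U * (U * (4/3 * z))"
          using U by (intro order_trans[OF Yle[OF x]] mult_left_mono) auto
      qed (use t in auto)
      also have "\<dots> = 4/3 * (t * \<xi>)" by (simp add: \<xi>_def power2_eq_square)
      also have "\<dots> = 4/15" using \<xi> by (simp add: t_def)
      finally show "\<bar>s * Y x\<bar> \<le> 4/15" .
    next
      have I2: "integrable M (\<lambda>x. (lin_comb h (V i) x)\<^sup>2)"
        unfolding power2_eq_square
        by (rule integrable_bounded_mult[OF _ _ abs_lin_comb_le])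
           (auto intro!: integrable_const_bound AE_I2 abs_lin_comb_le)
      have "(\<integral>x. (s * Y x)\<^sup>2 \<partial>M) \<le> (\<integral>x. (t\<^sup>2 * U\<^sup>2) * (lin_comb h (V i) x)\<^sup>2 \<partial>M)"
      proof (rule integral_mono_AE')
        show "AE x in M. (s * Y x)\<^sup>2 \<le> (t\<^sup>2 * U\<^sup>2) * (lin_comb h (V i) x)\<^sup>2"
        proof (rule AE_I2)
          fix x assume x: "x \<in> space M"
          have "\<bar>Y x\<bar>\<^sup>2 \<le> (U * \<bar>lin_comb h (V i) x\<bar>)\<^sup>2" using Yle[OF x] by (intro power_mono) auto
          then have "t\<^sup>2 * (Y x)\<^sup>2 \<le> t\<^sup>2 * (U\<^sup>2 * (lin_comb h (V i) x)\<^sup>2)"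
            by (intro mult_left_mono) (auto simp: power_mult_distrib)
          then show "(s * Y x)\<^sup>2 \<le> (t\<^sup>2 * U\<^sup>2) * (lin_comb h (V i) x)\<^sup>2"
            using s by (auto simp: power_mult_distrib)
        qed
      qed (use I2 in auto)
      also have "\<dots> \<le> (t\<^sup>2 * U\<^sup>2) * z" using V2[OF ij(2)] by (auto intro!: mult_left_mono)
      finally show "(\<integral>x. (s * Y x)\<^sup>2 \<partial>M) \<le> t\<^sup>2 * \<xi>" by (simp add: \<xi>_def mult_ac)
    qed (simp add: Y_def)
    moreover have "(\<integral>x. Y x \<partial>M) = m i j" unfolding Y_def m_def by (rule integral_h_lin_comb)
    ultimately show "(\<integral>\<^sup>+x. ennreal (exp (s * (h (snd p) x * lin_comb h (V (fst p)) x - m (fst p) (snd p)))) \<partial>M)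
        \<le> ennreal (exp K)"
      by (simp add: ij Y_def K_def)
  qed (use I in auto)
  then obtain E where E: "E \<in> sets (PiM {..<n} (\<lambda>_. M))"
    "measure (PiM {..<n} (\<lambda>_. M)) E \<ge> 1 - 2 * (real (card I) * real CARD('m)) * exp (- (236/10000 * (real n / \<xi>)))"
    "\<And>X i j. X \<in> E \<Longrightarrow> i \<in> I \<Longrightarrow> \<bar>emp_mean n X (\<lambda>x. h j x * lin_comb h (V i) x - m i j)\<bar> < 23/100"
    unfolding e card_cartesian_product by fastforce
  moreover have "2 * (real (card I) * real CARD('m)) * exp (- (236/10000 * (real n / \<xi>)))
      \<le> 2 * (real (card I) * real CARD('m)) * exp (- T)"
    using T by (intro mult_left_mono) (auto simp: \<xi>_def)
  ultimately show ?thesis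
    by (intro bexI[of _ E]) (auto simp: emp_mean_diff_const[OF n] m_def)
qed

text \<open>Noise and certificate share one Chernoff bound, with variance terms at most L / n and
  (49/128) L / n after scaling by \<open>t\<close>. There is one vector \<open>v\<close>, so the
  union runs over coordinates only.\<close>

lemma score_event:
  assumes n: "n > 0" and z: "z > 0" and U: "U > 0" and L: "L > 0" and lam: "lam > 0"
    and v1: "(\<Sum>j\<in>UNIV. \<bar>v$j\<bar>) \<le> 4/3 * z"
    and v2: "(\<integral>x. (lin_comb h v x)\<^sup>2 \<partial>M) \<le> z"
    and nL: "128 * (z * U\<^sup>2) * L \<le> real n" "128 * L \<le> real n"
    and \<epsilon>: "subgaussian M (\<tau>\<^sup>2) \<epsilon>" "\<epsilon> \<in> borel_measurable M"
    and lam_ge: "49 * U\<^sup>2 * L * \<tau>\<^sup>2 \<le> lam\<^sup>2 * real n"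
    and orth: "\<And>j. (\<integral>x. h j x * \<epsilon> x \<partial>M) = 0"
  shows "\<exists>E \<in> sets (PiM {..<n} (\<lambda>_. M)).
           measure (PiM {..<n} (\<lambda>_. M)) E \<ge> 1 - 2 * real CARD('m) * exp (- L) \<and>
           (\<forall>X\<in>E. \<forall>j. \<bar>emp_mean n X (\<lambda>x. h j x * (lin_comb h v x - \<epsilon> x / lam))
               - (\<Sum>k\<in>UNIV. gram M h j k * v $ k)\<bar> < 59/200)"
proof -
  note [measurable] = \<epsilon>(2)
  \<comment> \<open>With t = k L / n the exponent is at most 0.753 k^2 (1/128 + 1/49) - 0.295 k, in
    units of L / n; its minimizer is about 6.94.\<close>
  define t where "t = 7 * L / real n"
  have t: "t > 0" using L n by (simp add: t_def)
  have \<epsilon>1: "integrable M \<epsilon>"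
    by (rule square_integrable_imp_integrable[OF _ subgaussian_square(1)[OF \<epsilon>]]) simp
  have h\<epsilon>: "integrable M (\<lambda>x. h j x * \<epsilon> x)" for j
    by (rule integrable_bounded_mult[OF \<epsilon>1]) (auto intro: h_le)
  define W where "W = t\<^sup>2 * U\<^sup>2 * \<tau>\<^sup>2 / lam\<^sup>2"
  have W_le: "W \<le> L / real n"
  proof -
    have "W = 49 * U\<^sup>2 * L * \<tau>\<^sup>2 * (L / ((real n)\<^sup>2 * lam\<^sup>2))"
      by (simp add: W_def t_def power_divide power_mult_distrib power2_eq_square)
    also have "\<dots> \<le> lam\<^sup>2 * real n * (L / ((real n)\<^sup>2 * lam\<^sup>2))"
      using lam_ge L by (intro mult_right_mono) auto
    also have "\<dots> = L / real n" using n lam by (simp add: power2_eq_square)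
    finally show ?thesis .
  qed
  have Ln: "L / real n \<le> 1/128" using nL(2) n by (simp add: field_simps)
  have zLn: "z * U\<^sup>2 * (L / real n) \<le> 1/128" using nL(1) n by (simp add: field_simps)
  define m where "m = (\<lambda>j. \<Sum>k\<in>UNIV. gram M h j k * v $ k)"
  define K where "K = 753/1000 * (t\<^sup>2 * U\<^sup>2 * z + W)"
  \<comment> \<open>Here 177/128 = 49/128 + 1, and 0.753 * 177/128 - 7 * 0.295 < -1.\<close>
  have e: "real n * (K - t * (59/200)) \<le> - L"
  proof -
    have "t\<^sup>2 * U\<^sup>2 * z = 49 * (L / real n) * (z * U\<^sup>2 * (L / real n))"
      by (simp add: t_def power2_eq_square)
    also have "\<dots> \<le> 49 * (L / real n) * (1/128)"
      using zLn L by (intro mult_left_mono) auto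
    finally have "K \<le> 753/1000 * (177/128 * (L / real n))"
      unfolding K_def using W_le by (intro mult_left_mono) auto
    then have "K - t * (59/200) \<le> - (L / real n)"
      using L n by (simp add: t_def field_simps)
    then have "real n * (K - t * (59/200)) \<le> real n * (- (L / real n))"
      by (intro mult_left_mono) auto
    then show ?thesis using n by simp
  qed
  have "\<exists>E \<in> sets (PiM {..<n} (\<lambda>_. M)).
           measure (PiM {..<n} (\<lambda>_. M)) E \<ge> 1 - 2 * real CARD('m) * exp (real n * (K - t * (59/200))) \<and>
           (\<forall>X\<in>E. \<forall>j\<in>UNIV. \<bar>emp_mean n X (\<lambda>x. h j x * (lin_comb h v x - \<epsilon> x / lam) - m j)\<bar> < 59/200)"
  proof (rule chernoff_union[OF prob_space_axioms finite n t])
    fix j s assume s: "s = t \<or> s = - t"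
    define Z where "Z = (\<lambda>x. s * (h j x * (lin_comb h v x - \<epsilon> x / lam)))"
    \<comment> \<open>\<open>\<bar>h j x\<bar>\<close> is replaced by \<open>U\<close> before
      splitting, so p - q is a multiple of v^T h - \<epsilon> / lam; p is a combination of control
      variates and hence orthogonal to q.\<close>
    define p where "p = (\<lambda>x. t * U * lin_comb h v x)"
    define q where "q = (\<lambda>x. (t * U / lam) * \<epsilon> x)"
    have Z_int: "(\<integral>x. Z x \<partial>M) = s * m j"
    proof -
      have "Z = (\<lambda>x. s * (h j x * lin_comb h v x) - s / lam * (h j x * \<epsilon> x))"
        by (auto simp: Z_def algebra_simps)
      then show ?thesis using integral_h_lin_comb h\<epsilon> by (simp add: orth m_def)
    qed
    have "(\<integral>\<^sup>+x. ennreal (exp (Z x - (\<integral>x. Z x \<partial>M))) \<partial>M)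
        \<le> ennreal (exp (753/1000 * ((\<integral>x. (p x)\<^sup>2 \<partial>M) + W)))"
    proof (rule mgf_subgaussian_mix_le)
      show "Z \<in> borel_measurable M" "p \<in> borel_measurable M" "q \<in> borel_measurable M"
        by (simp_all add: Z_def p_def q_def)
      show "\<bar>Z x\<bar> \<le> \<bar>p x - q x\<bar>" if "x \<in> space M" for x
      proof -
        have "\<bar>Z x\<bar> = t * (\<bar>h j x\<bar> * \<bar>lin_comb h v x - \<epsilon> x / lam\<bar>)"
          using s t by (auto simp: Z_def abs_mult)
        also have "\<dots> \<le> t * (U * \<bar>lin_comb h v x - \<epsilon> x / lam\<bar>)"
          using t h_le[OF that] by (intro mult_left_mono mult_right_mono) auto
        also have "\<dots> = \<bar>(t * U) * (lin_comb h v x - \<epsilon> x / lam)\<bar>"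
          using t U by (simp add: abs_mult)
        also have "(t * U) * (lin_comb h v x - \<epsilon> x / lam) = p x - q x"
          by (simp add: p_def q_def algebra_simps)
        finally show ?thesis .
      qed
      show "\<bar>p x\<bar> \<le> 3/40" if "x \<in> space M" for x
      proof -
        have "\<bar>p x\<bar> = t * U * \<bar>lin_comb h v x\<bar>" using t U by (simp add: p_def abs_mult)
        also have "\<dots> \<le> t * U * (U * (4/3 * z))"
          using t U v1 by (intro mult_left_mono order_trans[OF abs_lin_comb_le[OF that]]) auto
        also have "\<dots> = 28/3 * (z * U\<^sup>2 * (L / real n))" by (simp add: t_def power2_eq_square mult_ac)
        also have "\<dots> \<le> 28/3 * (1/128)" by (intro mult_left_mono zLn) auto
        finally show ?thesis by simp
      qed
      show "subgaussian M W q"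
        unfolding subgaussian_def
      proof
        fix l
        have "(\<integral>\<^sup>+x. ennreal (exp (l * q x)) \<partial>M) = (\<integral>\<^sup>+x. ennreal (exp ((l * (t * U / lam)) * \<epsilon> x)) \<partial>M)"
          by (simp add: q_def mult.assoc)
        also have "\<dots> \<le> ennreal (exp ((l * (t * U / lam))\<^sup>2 * \<tau>\<^sup>2 / 2))"
          using \<epsilon>(1) unfolding subgaussian_def by blast
        also have "(l * (t * U / lam))\<^sup>2 * \<tau>\<^sup>2 / 2 = l\<^sup>2 * W / 2"
          by (simp add: W_def power_mult_distrib power_divide)
        finally show "(\<integral>\<^sup>+x. ennreal (exp (l * q x)) \<partial>M) \<le> ennreal (exp (l\<^sup>2 * W / 2))" .
      qed
      show "0 \<le> W" by (simp add: W_def)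
      show "W \<le> 1/128" using W_le Ln by linarith
      show "(\<integral>x. p x * q x \<partial>M) = 0"
      proof -
        have "(\<lambda>x. p x * q x) = (\<lambda>x. (t * U * (t * U / lam)) * (\<Sum>k\<in>UNIV. v$k * (h k x * \<epsilon> x)))"
          by (auto simp: p_def q_def lin_comb_def sum_distrib_left sum_distrib_right mult_ac)
        then show ?thesis using h\<epsilon> by (simp add: orth)
      qed
    qed
    also have "\<dots> \<le> ennreal (exp K)"
    proof -
      have "(\<integral>x. (p x)\<^sup>2 \<partial>M) = t\<^sup>2 * U\<^sup>2 * (\<integral>x. (lin_comb h v x)\<^sup>2 \<partial>M)"
        by (simp add: p_def power_mult_distrib)
      also have "\<dots> \<le> t\<^sup>2 * U\<^sup>2 * z" using v2 by (intro mult_left_mono) auto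
      finally show ?thesis by (simp add: K_def ennreal_leI)
    qed
    finally show "(\<integral>\<^sup>+x. ennreal (exp (s * (h j x * (lin_comb h v x - \<epsilon> x / lam) - m j))) \<partial>M) \<le> ennreal (exp K)"
      by (simp add: Z_int) (simp add: Z_def right_diff_distrib)
  qed simp
  then obtain E where E: "E \<in> sets (PiM {..<n} (\<lambda>_. M))"
    "measure (PiM {..<n} (\<lambda>_. M)) E \<ge> 1 - 2 * real CARD('m) * exp (real n * (K - t * (59/200)))"
    "\<And>X j. X \<in> E \<Longrightarrow> \<bar>emp_mean n X (\<lambda>x. h j x * (lin_comb h v x - \<epsilon> x / lam) - m j)\<bar> < 59/200"
    by auto
  have "2 * real CARD('m) * exp (real n * (K - t * (59/200))) \<le> 2 * real CARD('m) * exp (- L)"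
    using e by (intro mult_left_mono) auto
  then have "measure (PiM {..<n} (\<lambda>_. M)) E \<ge> 1 - 2 * real CARD('m) * exp (- L)"
    using E(2) by linarith
  with E(1,3) show ?thesis
    by (intro bexI[of _ E]) (auto simp: emp_mean_diff_const[OF n] m_def)
qed

end

section \<open>Intersection of the four events and the error of the estimator\<close>

theorem theorem2:
  fixes M :: "'a measure" and f :: "'a \<Rightarrow> real" and h :: "'m::finite \<Rightarrow> 'a \<Rightarrow> real"
    and \<beta>s :: "real^'m" and \<tau> \<gamma> \<delta> lam :: real and n :: nat
  assumes "prob_space M"
    and f_meas: "f \<in> borel_measurable M" and f_L2: "integrable M (\<lambda>x. (f x)\<^sup>2)"
    and h_meas: "\<And>j. h j \<in> borel_measurable M"
    and h_L2: "\<And>j. integrable M (\<lambda>x. (h j x)\<^sup>2)"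
    and h_centered: "\<And>j. (\<integral>x. h j x \<partial>M) = 0"
    and beta_min: "\<And>\<beta>. pop_risk M f h \<beta>s \<le> pop_risk M f h \<beta>"
    and S_ne: "supp_vec \<beta>s \<noteq> {}"
    and tau_pos: "\<tau> > 0"
    and subg: "subgaussian M (\<tau>\<^sup>2)
                 (\<lambda>x. f x - (\<integral>y. f y \<partial>M) - (\<Sum>j\<in>UNIV. \<beta>s$j * h j x))"
    and h_bdd: "\<exists>B. \<forall>j. \<forall>x\<in>space M. \<bar>h j x\<bar> \<le> B"
    and gamma_pos: "\<gamma> > 0"
    and RE: "\<And>u. u \<in> cone_set (supp_vec \<beta>s) 3 \<Longrightarrow>
               (\<Sum>j\<in>UNIV. \<Sum>k\<in>UNIV. u$j * gram M h j k * u$k) \<ge> \<gamma> * (norm u)\<^sup>2"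
    and delta: "0 < \<delta>" "\<delta> < 1"
    and n_large: "real n \<ge> max (8 * (real (card (supp_vec \<beta>s)) * (U_h M h)\<^sup>2 / \<gamma>)\<^sup>2
                                   * ln (8 * (real CARD('m))\<^sup>2 / \<delta>))
                               (128 * (real (card (supp_vec \<beta>s)) * (U_h M h)\<^sup>2 / \<gamma>)
                                   * ln (8 * real CARD('m) / \<delta>))"
    and lam_large: "lam \<ge> 7 * U_h M h * sqrt (ln (8 * real CARD('m) / \<delta>)) * \<tau> / sqrt (real n)"
  shows "\<exists>E \<in> sets (PiM {..<n} (\<lambda>_. M)).
           measure (PiM {..<n} (\<lambda>_. M)) E \<ge> 1 - \<delta> \<and>
           (\<forall>X\<in>E. \<forall>\<beta>. is_lasso_beta n X f h lam \<beta> \<longrightarrow>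
              \<bar>lasso_alpha n X f h \<beta> - (\<integral>x. f x \<partial>M)\<bar>
                 \<le> sqrt (2 * ln (8 / \<delta>)) * \<tau> / sqrt (real n)
                   + 68 * lam * real (card (supp_vec \<beta>s)) * sqrt (ln (8 * real CARD('m) / \<delta>))
                       * (U_h M h / \<gamma>) / sqrt (real n)
              \<and> (lam = 7 * U_h M h * sqrt (ln (8 * real CARD('m) / \<delta>)) * \<tau> / sqrt (real n) \<longrightarrow>
                 \<bar>lasso_alpha n X f h \<beta> - (\<integral>x. f x \<partial>M)\<bar>
                   \<le> sqrt (2 * ln (8 / \<delta>)) * \<tau> / sqrt (real n)
                     + 476 * real (card (supp_vec \<beta>s)) * ln (8 * real CARD('m) / \<delta>)
                         * ((U_h M h)\<^sup>2 / \<gamma>) * \<tau> / real n))"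
proof -
  define S where "S = supp_vec \<beta>s"
  define l where "l = card S"
  define m where "m = real CARD('m)"
  define U where "U = U_h M h"
  define z where "z = real l / \<gamma>"
  define L where "L = ln (8 * m / \<delta>)"
  define L1 where "L1 = ln (8 / \<delta>)"
  define \<mu> where "\<mu> = (\<integral>x. f x \<partial>M)"
  define \<epsilon> where "\<epsilon> = (\<lambda>x. f x - \<mu> - lin_comb h \<beta>s x)"
  have h_le: "\<bar>h j x\<bar> \<le> U" if "x \<in> space M" for j x
  proof -
    obtain B where "\<forall>j. \<forall>x\<in>space M. \<bar>h j x\<bar> \<le> B" using h_bdd by blast
    then have "bdd_above ((\<lambda>x. \<bar>h j x\<bar>) ` space M)" by (intro bdd_aboveI2[where M = B]) auto
    then have "\<bar>h j x\<bar> \<le> (SUP x\<in>space M. \<bar>h j x\<bar>)" using that by (intro cSUP_upper)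
    also have "\<dots> \<le> U" unfolding U_def U_h_def by (intro Max_ge) auto
    finally show ?thesis .
  qed
  interpret bounded_control_variates M h U
    using assms(1) h_meas h_le
    by (intro bounded_control_variates.intro bounded_control_variates_axioms.intro) auto
  interpret P: product_prob_space "\<lambda>_. M" "{..<n}" by unfold_locales
  let ?P = "PiM {..<n} (\<lambda>_. M)"

  have subg': "subgaussian M (\<tau>\<^sup>2) \<epsilon>" using subg by (simp add: \<epsilon>_def \<mu>_def lin_comb_def[abs_def])
  have \<epsilon>_meas: "\<epsilon> \<in> borel_measurable M" unfolding \<epsilon>_def using f_meas by measurable
  have orth: "(\<integral>x. h j x * \<epsilon> x \<partial>M) = 0" for j
    by (rule pop_risk_minimizer_orthogonal[of \<epsilon> f \<beta>s])
       (use \<epsilon>_meas subgaussian_square(1)[OF subg' \<epsilon>_meas] beta_min in \<open>auto simp: \<epsilon>_def \<mu>_def\<close>)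

  define q where "q = (\<lambda>u::real^'m. \<Sum>j\<in>UNIV. \<Sum>k\<in>UNIV. u$j * gram M h j k * u$k)"
  have q_eq: "q v = (\<integral>x. (lin_comb h v x)\<^sup>2 \<partial>M)" for v
    unfolding integral_lin_comb_sq by (simp add: q_def sum_distrib_left mult.assoc)
  have l_pos: "l \<ge> 1" using S_ne by (simp add: l_def S_def Suc_le_eq card_gt_0_iff)
  have l_le: "l \<le> CARD('m)" unfolding l_def by (intro card_mono) auto
  have z_pos: "z > 0" using l_pos gamma_pos by (simp add: z_def)
  \<comment> \<open>A coordinate vector of the support lies in the cone, and testing the eigenvalue
    condition on it gives \<gamma> \<le> E(h_j^2) \<le> U^2. This yields U > 0 and l \<le> \<xi>,
    hence 128 L \<le> n and n > 0.\<close>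
  have \<gamma>_le: "\<gamma> \<le> U\<^sup>2"
  proof -
    obtain j where j: "j \<in> S" using S_ne by (auto simp: S_def)
    have "axis j 1 \<in> cone_set S 3"
    proof -
      have "(\<Sum>k\<in>UNIV - S. \<bar>axis j (1::real) $ k\<bar>) = 0" using j by (intro sum.neutral) (auto simp: axis_def)
      then show ?thesis by (simp add: cone_set_def sum_nonneg)
    qed
    then have "\<gamma> * (norm (axis j (1::real)))\<^sup>2 \<le> q (axis j 1)" unfolding q_def S_def by (rule RE)
    then have "\<gamma> \<le> (\<integral>x. (lin_comb h (axis j 1) x)\<^sup>2 \<partial>M)" by (simp add: q_eq norm_axis_1)
    also have "\<dots> = (\<integral>x. (h j x)\<^sup>2 \<partial>M)"
      by (simp add: lin_comb_def axis_def if_distrib[of "\<lambda>x. x * _"] cong: if_cong)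
    also have "\<dots> \<le> (\<integral>x. U\<^sup>2 \<partial>M)"
    proof (rule integral_mono)
      fix x assume "x \<in> space M"
      from power_mono[OF h_le[OF this], of j 2] show "(h j x)\<^sup>2 \<le> U\<^sup>2" by simp
    qed (use h_L2 in auto)
    also have "\<dots> = U\<^sup>2" by (simp add: prob_space)
    finally show ?thesis .
  qed
  have U: "U > 0" using \<gamma>_le gamma_pos U_nonneg by (cases "U = 0") auto
  define \<xi> where "\<xi> = z * U\<^sup>2"
  have \<xi>_eq: "real (card (supp_vec \<beta>s)) * (U_h M h)\<^sup>2 / \<gamma> = \<xi>"
    by (simp add: \<xi>_def z_def l_def S_def U_def)
  have \<xi>_ge: "real l \<le> \<xi>"
    using mult_left_mono[OF \<gamma>_le, of "real l"] gamma_pos by (simp add: \<xi>_def z_def field_simps)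
  have n1: "real n \<ge> 8 * \<xi>\<^sup>2 * ln (8 * m\<^sup>2 / \<delta>)" and n2: "real n \<ge> 128 * \<xi> * L"
    using n_large unfolding \<xi>_eq by (auto simp: m_def L_def)
  have m1: "m \<ge> 1" using l_pos l_le by (simp add: m_def Suc_le_eq)
  have L1_pos: "L1 > 0" using delta by (simp add: L1_def)
  have L1_le: "L1 \<le> L" using m1 delta by (simp add: L1_def L_def divide_right_mono)
  have L_pos: "L > 0" using L1_pos L1_le by simp
  have nL: "128 * L \<le> real n"
  proof -
    have "128 * L * 1 \<le> 128 * L * \<xi>" using \<xi>_ge l_pos L_pos by (intro mult_left_mono) auto
    then show ?thesis using n2 by (simp add: mult_ac)
  qed
  have n: "n > 0" using nL L_pos by (cases n) auto
  define r where "r = sqrt (real n)"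
  have r: "r > 0" "r\<^sup>2 = real n" using n by (auto simp: r_def)
  define sL where "sL = sqrt L"
  have sL: "sL > 0" "sL\<^sup>2 = L" using L_pos by (auto simp: sL_def)
  have lam_ge: "lam \<ge> 7 * U * sL * \<tau> / r"
    using lam_large by (simp add: U_def sL_def L_def m_def r_def)
  then have lam: "lam > 0" using U sL r tau_pos by (smt (verit, best) divide_pos_pos mult_pos_pos)
  have lam_sq: "49 * U\<^sup>2 * L * \<tau>\<^sup>2 \<le> lam\<^sup>2 * real n"
  proof -
    have "7 * U * sL * \<tau> \<le> lam * r" using lam_ge r by (simp add: field_simps)
    then have "(7 * U * sL * \<tau>)\<^sup>2 \<le> (lam * r)\<^sup>2"
      using U sL tau_pos by (intro power_mono) auto
    then show ?thesis by (simp add: power_mult_distrib r sL)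
  qed

  \<comment> \<open>A sign pattern is encoded by the set \<open>A\<close> of indices carrying +1, so
    that the patterns on \<open>S\<close> are indexed by \<open>Pow S\<close>.\<close>
  have "\<exists>v. (\<forall>j\<in>S. (\<Sum>k\<in>UNIV. gram M h j k * v$k) = (if j \<in> A then 1 else -1))
      \<and> (\<forall>j. j \<notin> S \<longrightarrow> \<bar>\<Sum>k\<in>UNIV. gram M h j k * v$k\<bar> \<le> 1/3)
      \<and> q v \<le> z \<and> (\<Sum>j\<in>UNIV. \<bar>v$j\<bar>) \<le> 4/3 * z" for A
  proof (rule dual_certificate[of "gram M h" S \<gamma> "\<lambda>j. if j \<in> A then 1 else -1"])
    show "gram M h j k = gram M h k j" for j k by (simp add: gram_def mult.commute)
    show "0 \<le> (\<Sum>j\<in>UNIV. \<Sum>k\<in>UNIV. u$j * gram M h j k * u$k)" for u :: "real^'m"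
      using q_eq[of u] unfolding q_def by simp
    show "\<gamma> * (norm u)\<^sup>2 \<le> (\<Sum>j\<in>UNIV. \<Sum>k\<in>UNIV. u$j * gram M h j k * u$k)" if "u \<in> cone_set S 3" for u
      using that unfolding S_def by (rule RE)
  next
    fix v :: "real^'m"
    assume "\<And>j. j \<in> S \<Longrightarrow> (\<Sum>k\<in>UNIV. gram M h j k * v$k) = (if j \<in> A then 1 else -1)"
      and "\<And>j. j \<notin> S \<Longrightarrow> \<bar>\<Sum>k\<in>UNIV. gram M h j k * v$k\<bar> \<le> 1/3"
      and "(\<Sum>j\<in>UNIV. \<Sum>k\<in>UNIV. v$j * gram M h j k * v$k) \<le> real (card S) / \<gamma>"
      and "(\<Sum>j\<in>UNIV. \<bar>v$j\<bar>) \<le> 4/3 * (real (card S) / \<gamma>)"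
    then show "\<exists>v. (\<forall>j\<in>S. (\<Sum>k\<in>UNIV. gram M h j k * v$k) = (if j \<in> A then 1 else -1))
      \<and> (\<forall>j. j \<notin> S \<longrightarrow> \<bar>\<Sum>k\<in>UNIV. gram M h j k * v$k\<bar> \<le> 1/3)
      \<and> q v \<le> z \<and> (\<Sum>j\<in>UNIV. \<bar>v$j\<bar>) \<le> 4/3 * z" by (intro exI[of _ v]) (simp add: q_def z_def l_def)
  qed (use gamma_pos S_ne in \<open>auto simp: S_def\<close>)
  then have "\<exists>V. \<forall>A. (\<forall>j\<in>S. (\<Sum>k\<in>UNIV. gram M h j k * V A $ k) = (if j \<in> A then 1 else -1))
      \<and> (\<forall>j. j \<notin> S \<longrightarrow> \<bar>\<Sum>k\<in>UNIV. gram M h j k * V A $ k\<bar> \<le> 1/3)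
      \<and> q (V A) \<le> z \<and> (\<Sum>j\<in>UNIV. \<bar>V A $ j\<bar>) \<le> 4/3 * z"
    by (intro choice) blast
  then obtain V where V: "\<And>A j. j \<in> S \<Longrightarrow> (\<Sum>k\<in>UNIV. gram M h j k * V A $ k) = (if j \<in> A then 1 else -1)"
      "\<And>A j. j \<notin> S \<Longrightarrow> \<bar>\<Sum>k\<in>UNIV. gram M h j k * V A $ k\<bar> \<le> 1/3"
      "\<And>A. q (V A) \<le> z" "\<And>A. (\<Sum>j\<in>UNIV. \<bar>V A $ j\<bar>) \<le> 4/3 * z"
    by blast
  \<comment> \<open>The pattern -sigma: +1 exactly where the true coefficient is negative.\<close>
  define A0 where "A0 = {j\<in>S. \<beta>s$j < 0}"
  define G where "G = (\<lambda>v j. \<Sum>k\<in>UNIV. gram M h j k * v $ k)"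

  \<comment> \<open>Each event fails with probability at most \<delta>/4: this is 2 exp(-L1) for the
    noise, 2 m exp(-L) for the means and for the score, and 2 * 2^l * m * exp(-(L + l ln 2)) for the
    certificates.\<close>
  have expL: "exp (- L) = \<delta> / (8 * m)" using m1 delta by (simp add: L_def exp_minus)
  have expL1: "exp (- L1) = \<delta> / 8" using delta by (simp add: L1_def exp_minus)
  obtain E1 where E1: "E1 \<in> sets ?P" "measure ?P E1 \<ge> 1 - \<delta>/4"
    "\<And>X. X \<in> E1 \<Longrightarrow> \<bar>emp_mean n X \<epsilon>\<bar> < sqrt (2 * L1) * \<tau> / r"
    using noise_event[OF subg' \<epsilon>_meas tau_pos n L1_pos] unfolding expL1 r_def by auto
  obtain E2 where E2: "E2 \<in> sets ?P" "measure ?P E2 \<ge> 1 - \<delta>/4"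
    "\<And>X j. X \<in> E2 \<Longrightarrow> \<bar>emp_mean n X (h j)\<bar> < U * sqrt (2 * L / real n)"
    using mean_event[OF h_centered U n L_pos] m1 unfolding expL m_def[symmetric] by auto
  obtain E3 where E3: "E3 \<in> sets ?P" "measure ?P E3 \<ge> 1 - \<delta>/4"
    "\<And>X j. X \<in> E3 \<Longrightarrow> \<bar>emp_mean n X (\<lambda>x. h j x * (lin_comb h (V A0) x - \<epsilon> x / lam)) - G (V A0) j\<bar> < 59/200"
    using score_event[OF n z_pos U L_pos lam V(4) V(3)[unfolded q_eq] _ nL subg' \<epsilon>_meas lam_sq orth, of A0] n2 m1
    unfolding expL m_def[symmetric] G_def \<xi>_def by auto
  have T: "L + real l * ln 2 \<le> 236/10000 * (real n / (z * U\<^sup>2))"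
    using certificate_union_exponent[OF l_pos l_le delta \<xi>_ge] n1 n2
    by (simp add: L_def m_def \<xi>_def)
  have expT: "exp (- (L + real l * ln 2)) = \<delta> / (8 * m) / 2 ^ l"
  proof -
    have "exp (real l * ln 2) = (2::real) ^ l" by (simp add: exp_of_nat_mult)
    then show ?thesis by (simp add: exp_diff expL)
  qed
  have cardPow: "real (card (Pow S)) = 2 ^ l" by (simp add: card_Pow l_def)
  obtain E4 where E4: "E4 \<in> sets ?P" "measure ?P E4 \<ge> 1 - \<delta>/4"
    "\<And>X A j. X \<in> E4 \<Longrightarrow> A \<in> Pow S \<Longrightarrow> \<bar>emp_mean n X (\<lambda>x. h j x * lin_comb h (V A) x) - G (V A) j\<bar> < 23/100"
  proof -
    have fin: "finite (Pow S)" by simp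
    have ev: "\<exists>E \<in> sets ?P. measure ?P E \<ge> 1 - 2 * (2 ^ l * m) * (\<delta> / (8 * m) / 2 ^ l) \<and>
      (\<forall>X\<in>E. \<forall>A\<in>Pow S. \<forall>j. \<bar>emp_mean n X (\<lambda>x. h j x * lin_comb h (V A) x) - G (V A) j\<bar> < 23/100)"
      using certificate_event[where V = V, OF fin n z_pos U V(4) V(3)[unfolded q_eq] T]
      unfolding expT cardPow m_def[symmetric] G_def .
    have "2 * (2 ^ l * m) * (\<delta> / (8 * m) / 2 ^ l) = \<delta> / 4" using m1 by simp
    from ev[unfolded this] show ?thesis using that by blast
  qed
  define E where "E = E1 \<inter> E2 \<inter> (E3 \<inter> E4)"
  have E_sets: "E \<in> sets ?P" using E1 E2 E3 E4 by (auto simp: E_def)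
  have "measure ?P E \<ge> measure ?P (E1 \<inter> E2) + measure ?P (E3 \<inter> E4) - 1"
    unfolding E_def using E1 E2 E3 E4 by (intro P.prob_Int_ge) auto
  moreover have "measure ?P (E1 \<inter> E2) \<ge> measure ?P E1 + measure ?P E2 - 1"
    "measure ?P (E3 \<inter> E4) \<ge> measure ?P E3 + measure ?P E4 - 1"
    using E1 E2 E3 E4 by (auto intro!: P.prob_Int_ge)
  ultimately have E_ge: "measure ?P E \<ge> 1 - \<delta>" using E1(2) E2(2) E3(2) E4(2) by linarith

  define c where "c = U * sqrt (2 * L / real n)"
  have c_eq: "c = sqrt 2 * U * sL / r"
    by (simp add: c_def sL_def r_def real_sqrt_mult real_sqrt_divide)
  have c0: "c > 0" using U L_pos n by (simp add: c_def)
  have zc: "2 * z * c\<^sup>2 \<le> 1/32"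
  proof -
    have "2 * z * c\<^sup>2 = 4 * (\<xi> * L) / real n"
      using L_pos n by (simp add: c_def power_mult_distrib \<xi>_def mult_ac)
    also have "\<dots> \<le> 1/32" using n2 n by (simp add: divide_le_eq)
    finally show ?thesis .
  qed
  \<comment> \<open>From 128 L1 \<le> n comes the factor 1/8, and 17/12 bounds sqrt 2. Then 17/96 <
    91/500 = 7 * 13/500, where 7 is the constant in the lower bound on \<open>lam\<close>.\<close>
  have cc: "c * (sqrt (2 * L1) * \<tau> / r) \<le> 13/500 * lam"
  proof -
    have "sqrt (2 * L1) \<le> r / 8"
    proof (rule real_le_lsqrt)
      show "2 * L1 \<le> (r / 8)\<^sup>2" using nL L1_le by (simp add: power_divide r)
    qed (use r in auto)
    moreover have s2: "sqrt 2 \<le> 17/12" by (rule real_le_lsqrt) (auto simp: power2_eq_square)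
    ultimately have "c * (sqrt (2 * L1) * \<tau> / r) \<le> (17/12 * U * sL / r) * ((r / 8) * \<tau> / r)"
      unfolding c_eq using U sL r tau_pos L1_pos
      by (intro mult_mono divide_right_mono mult_right_mono) auto
    also have "\<dots> = 17/96 * (U * sL * \<tau> / r)" using r by simp
    also have "\<dots> \<le> 91/500 * (U * sL * \<tau> / r)"
      using U sL r tau_pos by (intro mult_right_mono) auto
    also have "\<dots> = 13/500 * (7 * U * sL * \<tau> / r)" by (simp add: mult.assoc)
    also have "\<dots> \<le> 13/500 * lam" using lam_ge by (intro mult_left_mono) auto
    finally show ?thesis .
  qed

  have bound: "\<bar>lasso_alpha n X f h \<beta> - \<mu>\<bar> \<le> sqrt (2 * L1) * \<tau> / r + 68 * lam * real l * sL * (U / \<gamma>) / r"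
    if X: "X \<in> E" and lasso: "is_lasso_beta n X f h lam \<beta>" for X \<beta>
  proof -
    have XE: "X \<in> E1" "X \<in> E2" "X \<in> E3" "X \<in> E4" using X by (auto simp: E_def)
    \<comment> \<open>This pattern depends on the sample through the estimator, so the fourth event
      covers all of \<open>Pow S\<close>; the bound then holds for every minimizer at once.\<close>
    define A1 where "A1 = {j\<in>S. \<beta>$j - \<beta>s$j \<ge> 0}"
    have A: "A0 \<in> Pow S" "A1 \<in> Pow S" by (auto simp: A0_def A1_def)
    have inS: "j \<in> S \<longleftrightarrow> \<beta>s$j \<noteq> 0" for j by (simp add: S_def supp_vec_def)
    have f_eq: "f x = \<mu> + lin_comb h \<beta>s x + \<epsilon> x" for x by (simp add: \<epsilon>_def)
    have c_le: "\<bar>emp_mean n X (h j)\<bar> \<le> c" for j using E2(3)[OF XE(2)] unfolding c_def by (rule less_imp_le)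
    have ce: "c * \<bar>emp_mean n X \<epsilon>\<bar> \<le> 13/500 * lam"
      by (rule order_trans[OF mult_left_mono cc]) (use E1(3)[OF XE(1)] c0 in auto)
    \<comment> \<open>The square is a combination of the functionals h_j v^T h with weights v_j, so
      their deviations already control it: 98/75 = 1 + (4/3) (23/100).\<close>
    have sq: "emp_mean n X (\<lambda>x. (lin_comb h (V A) x)\<^sup>2) \<le> 98/75 * z" if "A \<in> Pow S" for A
    proof -
      define D where "D = (\<lambda>j. emp_mean n X (\<lambda>x. h j x * lin_comb h (V A) x))"
      have "(\<lambda>x. (lin_comb h (V A) x)\<^sup>2) = (\<lambda>x. \<Sum>j\<in>UNIV. V A $ j * (h j x * lin_comb h (V A) x))"
        by (subst lin_comb_def[abs_def]) (auto simp: power2_eq_square lin_comb_def sum_distrib_right sum_distrib_left algebra_simps)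
      then have "emp_mean n X (\<lambda>x. (lin_comb h (V A) x)\<^sup>2) = (\<Sum>j\<in>UNIV. V A $ j * D j)"
        by (simp add: emp_mean_sum emp_mean_cmult D_def)
      also have "\<dots> \<le> (\<Sum>j\<in>UNIV. V A $ j * G (V A) j + \<bar>V A $ j\<bar> * (23/100))"
      proof (rule sum_mono)
        fix j
        have "\<bar>V A $ j * (D j - G (V A) j)\<bar> \<le> \<bar>V A $ j\<bar> * (23/100)"
          unfolding abs_mult using E4(3)[OF XE(4) that, of j] by (intro mult_left_mono) (auto simp: D_def)
        from abs_le_D1[OF this] show "V A $ j * D j \<le> V A $ j * G (V A) j + \<bar>V A $ j\<bar> * (23/100)"
          by (simp add: right_diff_distrib)
      qed
      also have "\<dots> = q (V A) + (\<Sum>j\<in>UNIV. \<bar>V A $ j\<bar>) * (23/100)"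
        by (simp only: q_eq integral_lin_comb_sq G_def sum.distrib sum_distrib_right)
      also have "\<dots> \<le> z + (4/3 * z) * (23/100)"
        by (intro add_mono mult_right_mono V) auto
      finally show ?thesis by simp
    qed
    have N: "(\<Sum>j\<in>UNIV. \<bar>\<beta>$j - \<beta>s$j\<bar>) \<le> 48 * lam * z"
    proof (rule lasso_l1_error_bound[OF n lasso f_eq lam V(4)[of A0] V(4)[of A1],
          where ?g0.0 = "G (V A0)" and ?g1.0 = "G (V A1)" and c = c])
      show "G (V A0) j = - sgn (\<beta>s$j)" if "\<beta>s$j \<noteq> 0" for j
        using that V(1)[of j A0] by (auto simp: G_def inS A0_def sgn_if)
      show "\<bar>G (V A0) j\<bar> \<le> 1/3" if "\<beta>s$j = 0" for j
        using that V(2)[of j A0] by (auto simp: G_def inS)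
      show "G (V A1) j = (if \<beta>$j - \<beta>s$j \<ge> 0 then 1 else -1)" if "\<beta>s$j \<noteq> 0" for j
        using that V(1)[of j A1] by (auto simp: G_def inS A1_def)
      show "\<bar>G (V A1) j\<bar> \<le> 1/3" if "\<beta>s$j = 0" for j
        using that V(2)[of j A1] by (auto simp: G_def inS)
    qed (use E3(3)[OF XE(3)] E4(3)[OF XE(4) A(2)] sq[OF A(1)] sq[OF A(2)] c_le zc ce in \<open>auto intro: less_imp_le\<close>)
    have "emp_mean n X f = \<mu> + emp_mean n X (lin_comb h \<beta>s) + emp_mean n X \<epsilon>"
    proof -
      have "f = (\<lambda>x. \<mu> + lin_comb h \<beta>s x + \<epsilon> x)" using f_eq by auto
      then show ?thesis using n by (simp add: emp_mean_add) (simp add: emp_mean_def)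
    qed
    then have "lasso_alpha n X f h \<beta> - \<mu> = emp_mean n X \<epsilon> - (\<Sum>j\<in>UNIV. (\<beta>$j - \<beta>s$j) * emp_mean n X (h j))"
      unfolding lasso_alpha_def lin_comb_def[symmetric]
      by (simp add: emp_mean_diff emp_mean_lin_comb left_diff_distrib sum_subtractf)
    moreover have "\<bar>\<Sum>j\<in>UNIV. (\<beta>$j - \<beta>s$j) * emp_mean n X (h j)\<bar> \<le> (48 * lam * z) * c"
    proof -
      have "\<bar>\<Sum>j\<in>UNIV. (\<beta>$j - \<beta>s$j) * emp_mean n X (h j)\<bar> \<le> (\<Sum>j\<in>UNIV. \<bar>\<beta>$j - \<beta>s$j\<bar> * c)"
        by (rule order_trans[OF sum_abs]) (auto simp: abs_mult intro!: sum_mono mult_left_mono c_le)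
      also have "\<dots> \<le> (48 * lam * z) * c"
        unfolding sum_distrib_right[symmetric] using N c0 by (intro mult_right_mono) auto
      finally show ?thesis .
    qed
    moreover have "(48 * lam * z) * c \<le> 68 * lam * real l * sL * (U / \<gamma>) / r"
    proof -
      have "48 * sqrt 2 \<le> (68::real)"
      proof -
        have "sqrt 2 \<le> (17/12::real)" by (rule real_le_lsqrt) (auto simp: power2_eq_square)
        then show ?thesis by simp
      qed
      then have "48 * sqrt 2 * (lam * real l * sL * (U / \<gamma>) / r) \<le> 68 * (lam * real l * sL * (U / \<gamma>) / r)"
        using lam sL U gamma_pos r by (intro mult_right_mono) auto
      then show ?thesis by (simp add: c_eq z_def mult_ac)
    qed
    ultimately show ?thesis using E1(3)[OF XE(1)] by linarith
  qed
  \<comment> \<open>The constant is 476 = 7 * 68.\<close>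
  have opt: "68 * lam * real l * sL * (U / \<gamma>) / r = 476 * real l * L * (U\<^sup>2 / \<gamma>) * \<tau> / real n"
    if "lam = 7 * U * sL * \<tau> / r"
    unfolding that sL(2)[symmetric] r(2)[symmetric] by (simp add: power2_eq_square mult_ac)
  show ?thesis
    unfolding U_def[symmetric] S_def[symmetric] l_def[symmetric] m_def[symmetric] L_def[symmetric]
      L1_def[symmetric] \<mu>_def[symmetric] r_def[symmetric] sL_def[symmetric]
  proof (intro bexI[OF _ E_sets] conjI E_ge ballI allI impI)
    fix X \<beta> assume X: "X \<in> E" "is_lasso_beta n X f h lam \<beta>"
    show le: "\<bar>lasso_alpha n X f h \<beta> - \<mu>\<bar> \<le> sqrt (2 * L1) * \<tau> / r + 68 * lam * real l * sL * (U / \<gamma>) / r"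
      by (rule bound[OF X])
    show "\<bar>lasso_alpha n X f h \<beta> - \<mu>\<bar> \<le> sqrt (2 * L1) * \<tau> / r + 476 * real l * L * (U\<^sup>2 / \<gamma>) * \<tau> / real n"
      if "lam = 7 * U * sL * \<tau> / r"
      using le unfolding opt[OF that] .
  qed
qed

end
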